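(* Let $C$ be a completely regular code in $J(n,4)$ with covering radius $2$ and $Spec(C)=\{\theta_0(n,4),\theta_2(n,4),\theta_3(n,4)\}$. Then $C$ has intersection matrix $$\begin{pmatrix} 4n-16-\beta_0 & \beta_0 & 0\\ -\frac{(\beta_0-2n+2)(\beta_0-3n+6)}{\beta_0-\gamma_2} & \beta_0+\gamma_2-n-8 & \frac{(\gamma_2-2n+2)(\gamma_2-3n+6)}{\beta_0-\gamma_2}\\ 0 & \gamma_2 & 4n-16-\gamma_2\end{pmatrix}$$ for some distinct positive integers $\beta_0$ and $\gamma_2$.
   Context: The Johnson graph $J(n,4)$ has as vertices the $4$-subsets of $\{1,\dots,n\}$ ($n\ge 8$), adjacent iff they meet in a $3$-subset; its eigenvalues are $\theta_i(n,4)=(n-4-i)(4-i)-i$, $i=0,\dots,4$. For a code $C$, $C_i$ is the set of vertices at distance exactly $i$ from $C$, the covering radius $\rho$ is the largest $i$ with $C_i\ne\emptyset$; $C$ is completely regular if there are numbers $\alpha_i,\beta_i,\gamma_i$ such that each vertex of $C_i$ has exactly $\alpha_i,\beta_i,\gamma_i$ neighbours in $C_i,C_{i+1},C_{i-1}$. The intersection matrix is the $(\rho+1)\times(\rho+1)$ tridiagonal matrix with diagonal $\alpha_0,\dots,\alpha_\rho$, superdiagonal $\beta_0,\dots,\beta_{\rho-1}$, subdiagonal $\gamma_1,\dots,\gamma_\rho$, and $Spec(C)$ is its set of eigenvalues. *)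

theory Defs
  imports "Jordan_Normal_Form.Spectral_Radius" "HOL-Library.Extended_Nat"
begin

text \<open>A graph is given by its vertex set \<open>V\<close> and its symmetric adjacency relation
  \<open>E \<subseteq> V \<times> V\<close>; walks of length \<open>k\<close> are the elements of the relational power \<open>E ^^ k\<close>.\<close>

definition johnson_vertices :: "nat \<Rightarrow> nat \<Rightarrow> nat set set" where
  "johnson_vertices n k = {x. x \<subseteq> {1..n} \<and> card x = k}"

definition johnson_edges :: "nat \<Rightarrow> nat \<Rightarrow> (nat set) rel" where
  "johnson_edges n k =
     {(x, y). x \<in> johnson_vertices n k \<and> y \<in> johnson_vertices n k \<and> card (x \<inter> y) + 1 = k}"

definition johnson_eigenvalue :: "nat \<Rightarrow> nat \<Rightarrow> nat \<Rightarrow> real" where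
  "johnson_eigenvalue n k i =
     (real n - real k - real i) * (real k - real i) - real i"

definition graph_dist :: "'a rel \<Rightarrow> 'a \<Rightarrow> 'a \<Rightarrow> enat" where
  "graph_dist E u v = Inf {enat k | k. (u, v) \<in> E ^^ k}"

definition code_dist :: "'a rel \<Rightarrow> 'a set \<Rightarrow> 'a \<Rightarrow> enat" where
  "code_dist E C v = (INF c\<in>C. graph_dist E v c)"

definition code_layer :: "'a set \<Rightarrow> 'a rel \<Rightarrow> 'a set \<Rightarrow> nat \<Rightarrow> 'a set" where
  "code_layer V E C i = {v \<in> V. code_dist E C v = enat i}"

text \<open>Meaningful for nonempty \<open>C \<subseteq> V\<close> with \<open>V\<close> finite; then the set below is finite and contains \<open>0\<close>.\<close>

definition covering_radius :: "'a set \<Rightarrow> 'a rel \<Rightarrow> 'a set \<Rightarrow> nat" where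
  "covering_radius V E C = Max {i. code_layer V E C i \<noteq> {}}"

definition nbrs_in :: "'a rel \<Rightarrow> 'a \<Rightarrow> 'a set \<Rightarrow> nat" where
  "nbrs_in E v S = card {u \<in> S. (v, u) \<in> E}"

text \<open>The layer before layer \<open>0\<close> is empty; natural-number subtraction would give layer \<open>0\<close> instead.\<close>

definition prev_layer :: "'a set \<Rightarrow> 'a rel \<Rightarrow> 'a set \<Rightarrow> nat \<Rightarrow> 'a set" where
  "prev_layer V E C i = (if i = 0 then {} else code_layer V E C (i - 1))"

definition completely_regular :: "'a set \<Rightarrow> 'a rel \<Rightarrow> 'a set \<Rightarrow> bool" where
  "completely_regular V E C \<longleftrightarrow> C \<subseteq> V \<and> C \<noteq> {} \<and>
     (\<exists>\<alpha> \<beta> \<gamma> :: nat \<Rightarrow> nat. \<forall>i. \<forall>v \<in> code_layer V E C i.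
        nbrs_in E v (code_layer V E C i) = \<alpha> i \<and>
        nbrs_in E v (code_layer V E C (i + 1)) = \<beta> i \<and>
        nbrs_in E v (prev_layer V E C i) = \<gamma> i)"

text \<open>For a completely regular code these are well defined for every \<open>i\<close> up to the covering
  radius, since the corresponding layers are nonempty.\<close>

definition code_alpha :: "'a set \<Rightarrow> 'a rel \<Rightarrow> 'a set \<Rightarrow> nat \<Rightarrow> nat" where
  "code_alpha V E C i =
     (THE a. \<forall>v \<in> code_layer V E C i. nbrs_in E v (code_layer V E C i) = a)"

definition code_beta :: "'a set \<Rightarrow> 'a rel \<Rightarrow> 'a set \<Rightarrow> nat \<Rightarrow> nat" where
  "code_beta V E C i =
     (THE b. \<forall>v \<in> code_layer V E C i. nbrs_in E v (code_layer V E C (i + 1)) = b)"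

definition code_gamma :: "'a set \<Rightarrow> 'a rel \<Rightarrow> 'a set \<Rightarrow> nat \<Rightarrow> nat" where
  "code_gamma V E C i =
     (THE c. \<forall>v \<in> code_layer V E C i. nbrs_in E v (prev_layer V E C i) = c)"

definition intersection_matrix :: "'a set \<Rightarrow> 'a rel \<Rightarrow> 'a set \<Rightarrow> real mat" where
  "intersection_matrix V E C =
     (let m = covering_radius V E C + 1 in
      mat m m (\<lambda>(i, j).
        if j = i then real (code_alpha V E C i)
        else if j = i + 1 then real (code_beta V E C i)
        else if i = j + 1 then real (code_gamma V E C i)
        else 0))"

text \<open>All eigenvalues of an intersection matrix are real: it is tridiagonal with
  \<open>\<beta>\<^sub>i \<gamma>\<^sub>i\<^sub>+\<^sub>1 > 0\<close>, so the real spectrum is the full one.\<close>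

definition code_spec :: "'a set \<Rightarrow> 'a rel \<Rightarrow> 'a set \<Rightarrow> real set" where
  "code_spec V E C = spectrum (intersection_matrix V E C)"

end

theory Submission imports Defs begin

text \<open>The intersection matrix has row sums \<open>4n - 16\<close>, so the two nontrivial eigenvalues determine its
  trace and second symmetric function; solving for the remaining entries gives the displayed matrix
  as soon as \<open>\<beta>\<^sub>0 \<noteq> \<gamma>\<^sub>2\<close>. If \<open>\<beta>\<^sub>0 = \<gamma>\<^sub>2\<close>, then both equal \<open>2n - 2\<close> and \<open>\<beta>\<^sub>1 + \<gamma>\<^sub>1 = n - 4\<close>.

  To exclude this, write \<open>{b, B} = {\<beta>\<^sub>1, \<gamma>\<^sub>1}\<close> with \<open>b \<le> B\<close> and let \<open>f\<close> be \<open>B\<close> on one of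
  \<open>C\<^sub>0\<close>, \<open>C\<^sub>2\<close> (called \<open>X\<close>), \<open>- b\<close> on the other and \<open>0\<close> on \<open>C\<^sub>1\<close>. This is an eigenfunction for
  \<open>\<theta>\<^sub>2\<close>, hence \<open>f x\<close> is the sum of a weight \<open>g\<close> over the pairs inside \<open>x\<close>. Consequently every triple
  sum of \<open>u\<^sub>i\<^sub>j y = g i y - g j y\<close> is a difference of values of \<open>f\<close> at adjacent vertices, i.e. one of
  \<open>0, \<plusminus>B, \<plusminus>b\<close>. Around a vertex \<open>x \<in> X\<close> this is so restrictive that \<open>n\<close> is odd and all points of \<open>x\<close>
  are twins with respect to \<open>g\<close>. The twin class of a point of \<open>x\<close> has \<open>(n + 1) / 2\<close> elements, so there is
  only one, \<open>W\<close>, and it contains all members of \<open>X\<close>; but then a vertex meeting \<open>W\<close> in one point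
  is too far from \<open>X\<close>. For \<open>n = 8\<close> a count of edges suffices.\<close>

section \<open>Eigenfunctions on four-element sets\<close>

text \<open>With \<open>h3\<close>, \<open>h2\<close> the sums of \<open>f\<close> over supersets, the commutation of the up and down operators makes
  \<open>f\<close> proportional to the up-image of \<open>h3\<close>, and \<open>h3\<close> proportional to that of \<open>h2\<close>.\<close>

lemma four_set_pair_weights:
  fixes f :: "'a set \<Rightarrow> real"
  assumes fin: "finite A" and n: "n = card A" "n \<ge> 6"
    and eig: "\<And>x. x \<subseteq> A \<Longrightarrow> card x = 4 \<Longrightarrow>
      (\<Sum>i\<in>x. \<Sum>y\<in>A - x. f (insert y (x - {i}))) = (2 * real n - 14) * f x"
  obtains g :: "'a \<Rightarrow> 'a \<Rightarrow> real" where
    "\<And>a b. g a b = g b a"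
    "\<And>a b c. {a,b,c} \<subseteq> A \<Longrightarrow> distinct [a,b,c] \<Longrightarrow>
      (\<Sum>y\<in>A - {a,b,c}. f (insert y {a,b,c})) = (real n - 5) * (g a b + g a c + g b c)"
    "\<And>a b c d. {a,b,c,d} \<subseteq> A \<Longrightarrow> distinct [a,b,c,d] \<Longrightarrow>
      f {a,b,c,d} = g a b + g a c + g a d + g b c + g b d + g c d"
proof -
  define h3 where "h3 T = (\<Sum>y\<in>A - T. f (insert y T))" for T
  define h2 where "h2 P = (\<Sum>y\<in>A - P. h3 (insert y P))" for P
  \<comment> \<open>Among the points that can be added, \<open>y = i\<close> restores
    \<open>S\<close>; splitting it off leaves the genuine exchanges that \<open>eig\<close> speaks
    about.\<close>
  have pull: "(\<Sum>y\<in>A - (S - {i}). h (insert y (S - {i}))) =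
      h S + (\<Sum>y\<in>A - S. h (insert y (S - {i})))"
    if "i \<in> S" "S \<subseteq> A" for h :: "'a set \<Rightarrow> real" and S i
  proof -
    have "A - (S - {i}) = insert i (A - S)" using that by auto
    then show ?thesis using that fin by (simp add: insert_absorb)
  qed
  have up3: "(\<Sum>i\<in>x. h3 (x - {i})) = (2 * real n - 10) * f x" if "x \<subseteq> A" "card x = 4" for x
  proof -
    have "(\<Sum>i\<in>x. h3 (x - {i})) = (\<Sum>i\<in>x. f x + (\<Sum>y\<in>A - x. f (insert y (x - {i}))))"
      unfolding h3_def using that by (intro sum.cong refl pull) auto
    also have "\<dots> = 4 * f x + (2 * real n - 14) * f x"
      using eig[OF that] that by (simp add: sum.distrib)
    finally show ?thesis by (simp add: algebra_simps)
  qed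
  have up2: "(\<Sum>t\<in>T. h2 (T - {t})) = (real n - 4) * h3 T" if T: "T \<subseteq> A" "card T = 3" for T
  proof -
    have finT: "finite T" using T fin finite_subset by blast
    define R where "R = (\<Sum>t\<in>T. \<Sum>y\<in>A - T. h3 (insert y (T - {t})))"
    have "(\<Sum>t\<in>T. h2 (T - {t})) = (\<Sum>t\<in>T. h3 T + (\<Sum>y\<in>A - T. h3 (insert y (T - {t}))))"
      unfolding h2_def using that by (intro sum.cong refl pull) auto
    also have "\<dots> = 3 * h3 T + R" using T by (simp add: sum.distrib R_def)
    finally have 1: "(\<Sum>t\<in>T. h2 (T - {t})) = 3 * h3 T + R" .
    \<comment> \<open>Summing \<open>up3\<close> over all four-element supersets of \<open>T\<close>
      yields the same exchange sum \<open>R\<close>, now with \<open>n - 3\<close> diagonal terms;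
      comparison with \<open>1\<close> eliminates \<open>R\<close>.\<close>
    have "(2 * real n - 10) * h3 T = (\<Sum>y\<in>A - T. \<Sum>i\<in>insert y T. h3 (insert y T - {i}))"
      unfolding h3_def[of T] sum_distrib_left using T finT
      by (intro sum.cong refl) (subst up3, auto)
    also have "\<dots> = (\<Sum>y\<in>A - T. h3 T + (\<Sum>t\<in>T. h3 (insert y (T - {t}))))"
    proof (intro sum.cong refl)
      fix y assume y: "y \<in> A - T"
      have "h3 (insert y T - {t}) = h3 (insert y (T - {t}))" if "t \<in> T" for t
        using that y by (metis Diff_iff insert_Diff_if singletonD)
      then show "(\<Sum>i\<in>insert y T. h3 (insert y T - {i})) = h3 T + (\<Sum>t\<in>T. h3 (insert y (T - {t})))"
        using y finT by simp
    qed
    also have "\<dots> = (real n - 3) * h3 T + R"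
    proof -
      have "card (A - T) = n - 3" using T fin finT n by (simp add: card_Diff_subset)
      moreover have "R = (\<Sum>y\<in>A - T. \<Sum>t\<in>T. h3 (insert y (T - {t})))"
        unfolding R_def by (rule sum.swap)
      ultimately show ?thesis using n by (simp add: sum.distrib of_nat_diff)
    qed
    finally show ?thesis using 1 by (simp add: algebra_simps)
  qed
  \<comment> \<open>\<open>n - 4\<close> is the factor in \<open>up2\<close>; \<open>n - 5\<close>
    is half of the factor in \<open>up3\<close>, because each pair in a four-element set lies in two
    of its triples.\<close>
  define g where "g a b = h2 {a,b} / ((real n - 4) * (real n - 5))" for a b
  have g3: "h3 {a,b,c} = (real n - 5) * (g a b + g a c + g b c)"
    if "{a,b,c} \<subseteq> A" "distinct [a,b,c]" for a b c
  proof -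
    have d: "{a,b,c} - {a} = {b,c}" "{a,b,c} - {b} = {a,c}" "{a,b,c} - {c} = {a,b}"
      using that by auto
    have "(real n - 4) * h3 {a,b,c} = h2 {b,c} + (h2 {a,c} + h2 {a,b})"
      using up2[of "{a,b,c}"] that d by simp
    moreover have "(real n - 4) * ((real n - 5) * g p q) = h2 {p,q}" for p q
      using n by (simp add: g_def)
    ultimately have "(real n - 4) * h3 {a,b,c} = (real n - 4) * ((real n - 5) * (g a b + g a c + g b c))"
      by (simp only: distrib_left)
    then show ?thesis using n by simp
  qed
  have g4: "f {a,b,c,d} = g a b + g a c + g a d + g b c + g b d + g c d"
    if "{a,b,c,d} \<subseteq> A" "distinct [a,b,c,d]" for a b c d
  proof -
    have d: "{a,b,c,d} - {a} = {b,c,d}" "{a,b,c,d} - {b} = {a,c,d}" "{a,b,c,d} - {c} = {a,b,d}"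
        "{a,b,c,d} - {d} = {a,b,c}"
      using that by auto
    have "(2 * real n - 10) * f {a,b,c,d} = h3 {b,c,d} + (h3 {a,c,d} + (h3 {a,b,d} + h3 {a,b,c}))"
      using up3[of "{a,b,c,d}"] that d by simp
    also have "\<dots> = (2 * real n - 10) * (g a b + g a c + g a d + g b c + g b d + g c d)"
      using that by (simp add: g3 algebra_simps)
    finally show ?thesis using n by simp
  qed
  have "g a b = g b a" for a b by (simp add: g_def insert_commute)
  then show thesis using that g3 g4 unfolding h3_def by blast
qed

section \<open>Choosing distinct points, and classifying rows by their triple sums\<close>

lemma card_ge_1_obtain: "card S \<ge> 1 \<Longrightarrow> \<exists>a. a \<in> S"
  by (cases "S = {}") auto

lemma card_ge_2_obtain: "card S \<ge> 2 \<Longrightarrow> \<exists>a b. a \<in> S \<and> b \<in> S \<and> a \<noteq> b"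
  using card_le_Suc0_iff_eq[of S] card_ge_0_finite[of S] by fastforce

lemma card_ge_3_obtain:
  assumes "card S \<ge> 3" shows "\<exists>a b c. a \<in> S \<and> b \<in> S \<and> c \<in> S \<and> distinct [a,b,c]"
proof -
  obtain T where T: "T \<subseteq> S" "card T = 3" by (rule obtain_subset_with_card_n[OF assms])
  obtain a b c where "T = {a,b,c}" "a \<noteq> b" "b \<noteq> c" "a \<noteq> c"
    using T(2) unfolding card_3_iff by (elim exE conjE)
  then show ?thesis using T(1) by (intro exI[of _ a] exI[of _ b] exI[of _ c]) simp
qed

text \<open>Here \<open>\<omega>\<close> is the normalised difference of two rows of the neighbourhood grid of a vertex, \<open>\<delta>\<close> their
  entrywise difference, and \<open>s = b / B\<close>. Since all triple sums lie in \<open>[-1, 1]\<close>, few entries can differ.\<close>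

lemma triple_sum_classification:
  fixes U :: "'a \<Rightarrow> real" and \<delta> :: "'a \<Rightarrow> int" and s \<omega> :: real
  assumes Y: "finite Y" "card Y + 4 = n" and n: "n \<ge> 9"
    and kl: "k \<notin> Y" "l \<notin> Y" "k \<noteq> l"
    and U: "\<And>y. y \<in> Y \<Longrightarrow> U y = \<omega> + of_int (\<delta> y)"
    and \<delta>: "\<And>y. y \<in> Y \<Longrightarrow> \<delta> y \<in> {-1,0,1}"
    and Ukl: "U k + U l = - \<omega>"
    and \<omega>: "\<omega> * (real n - 5) = - of_int (\<Sum>y\<in>Y. \<delta> y)" "\<omega> \<ge> 0"
    and s: "0 < s" "s \<le> 1" "s * (real n - 5) \<noteq> 3"
    and triple: "\<And>a b c. {a,b,c} \<subseteq> insert k (insert l Y) \<Longrightarrow> distinct [a,b,c] \<Longrightarrow>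
       U a + U b + U c \<in> {0,1,-1,s,-s}"
  shows "\<omega> = 0 \<and> (\<forall>y\<in>Y. \<delta> y = 0) \<or>
    \<omega> \<in> {0,1} \<and> (\<exists>a M. a \<in> Y \<and> U a = 1 \<and> M \<subseteq> insert k (insert l Y) - {a} \<and> card M + 5 \<ge> n \<and>
      (\<forall>c\<in>M. U c = 0))"
proof -
  define P where "P = {y\<in>Y. \<delta> y = 1}"
  define Q where "Q = {y\<in>Y. \<delta> y = -1}"
  define Z where "Z = {y\<in>Y. \<delta> y = 0}"
  have finPQZ: "finite P" "finite Q" "finite Z" using Y by (auto simp: P_def Q_def Z_def)
  have Yd: "Y = P \<union> (Q \<union> Z)" using \<delta> by (auto simp: P_def Q_def Z_def)
  have dis: "P \<inter> (Q \<union> Z) = {}" "Q \<inter> Z = {}" by (auto simp: P_def Q_def Z_def)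
  have "card Y = card P + (card Q + card Z)"
    unfolding Yd using finPQZ dis by (simp add: card_Un_disjoint)
  then have cardPQZ: "card P + card Q + card Z + 4 = n" using Y by simp
  have "(\<Sum>y\<in>Y. \<delta> y) = (\<Sum>y\<in>P. \<delta> y) + ((\<Sum>y\<in>Q. \<delta> y) + (\<Sum>y\<in>Z. \<delta> y))"
    unfolding Yd using finPQZ dis by (simp add: sum.union_disjoint)
  also have "\<dots> = int (card P) - int (card Q)" by (simp add: P_def Q_def Z_def)
  finally have w: "\<omega> * (real n - 5) = real (card Q) - real (card P)" using \<omega> by simp
  have UP: "U y = \<omega> + 1" if "y \<in> P" for y using that U by (auto simp: P_def)
  have UQ: "U y = \<omega> - 1" if "y \<in> Q" for y using that U by (auto simp: Q_def)
  have UZ: "U y = \<omega>" if "y \<in> Z" for y using that U by (auto simp: Z_def)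
  have bd: "\<bar>U a + U b + U c\<bar> \<le> 1" if "{a,b,c} \<subseteq> insert k (insert l Y)" "distinct [a,b,c]" for a b c
    using triple[OF that] s by auto
  have sub: "P \<subseteq> Y" "Q \<subseteq> Y" "Z \<subseteq> Y" by (auto simp: P_def Q_def Z_def)
  have n5: "real n - 5 > 0" using n by simp
  \<comment> \<open>The value \<open>3 / (n - 5)\<close> equals 1 only for \<open>n = 8\<close>;
    that it equals \<open>s\<close> is excluded by assumption.\<close>
  have ne: "r \<notin> {1, s}" if "r * (real n - 5) = 3" for r
  proof -
    have "r \<noteq> 1" using that n by auto
    then show ?thesis using that s by auto
  qed
  consider "\<omega> > 0" "card P \<ge> 1" | "\<omega> > 0" "card P = 0" | "\<omega> = 0" using \<omega> by linarith
  then show ?thesis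
  proof cases
    \<comment> \<open>Two elements of \<open>P\<close> with one of \<open>Q\<close> would sum to
      \<open>3 * \<omega> + 1 > 1\<close>, so \<open>P\<close> is a singleton. The other triples
      keep \<open>\<omega>\<close> too small for the nearly \<open>n\<close> elements left to
      \<open>Q\<close>.\<close>
    case 1
    have QP: "card Q > card P" using w 1 n5 by (smt (verit) mult_pos_pos of_nat_less_iff)
    have "card P \<le> 1"
    proof (rule ccontr)
      assume "\<not> card P \<le> 1"
      then obtain a b where ab: "a \<in> P" "b \<in> P" "a \<noteq> b" using card_ge_2_obtain[of P] by auto
      obtain c where "c \<in> Q" using card_ge_1_obtain[of Q] QP by auto
      then have "\<bar>U a + U b + U c\<bar> \<le> 1" using ab sub dis by (intro bd) auto
      then show False using UP UQ ab \<open>c \<in> Q\<close> 1 by force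
    qed
    then have P1: "card P = 1" using 1 by simp
    then obtain a where a: "a \<in> P" using card_ge_1_obtain[of P] by auto
    obtain c d where cd: "c \<in> Q" "d \<in> Q" "c \<noteq> d" using card_ge_2_obtain[of Q] QP P1 by auto
    have "\<bar>U a + U c + U d\<bar> \<le> 1" using cd a sub dis by (intro bd) auto
    then have w2: "3 * \<omega> \<le> 2" using UP[OF a] UQ cd by force
    have Z0: "3 * \<omega> \<le> 1 \<and> card Z = 1" if Z: "card Z \<ge> 1"
    proof
      obtain z where z: "z \<in> Z" using card_ge_1_obtain[OF Z] by blast
      have "\<bar>U a + U c + U z\<bar> \<le> 1" using cd a z sub dis by (intro bd) auto
      then show "3 * \<omega> \<le> 1" using UP[OF a] UQ cd UZ[OF z] by force
      show "card Z = 1"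
      proof (rule ccontr)
        assume "card Z \<noteq> 1"
        then obtain z z' where z: "z \<in> Z" "z' \<in> Z" "z \<noteq> z'" using card_ge_2_obtain[of Z] Z by auto
        have "\<bar>U a + U z' + U z\<bar> \<le> 1" using cd a z sub dis by (intro bd) auto
        then show False using UP[OF a] UZ z 1 by force
      qed
    qed
    show ?thesis
    proof (cases "card Z \<ge> 1")
      case True
      then have "real (card Q) = real n - 6" using cardPQZ P1 Z0 by simp
      moreover have "3 * (\<omega> * (real n - 5)) \<le> real n - 5"
        using Z0[OF True] n5 mult_right_mono[of "3*\<omega>" 1 "real n - 5"] by simp
      ultimately show ?thesis using w P1 n by simp
    next
      case False
      then have "real (card Q) = real n - 5" using cardPQZ P1 by simp
      moreover have "3 * (\<omega> * (real n - 5)) \<le> 2 * (real n - 5)"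
        using w2 n5 mult_right_mono[of "3*\<omega>" 2 "real n - 5"] by simp
      ultimately show ?thesis using w P1 n by simp
    qed
  next
    case 2
    then have w': "\<omega> * (real n - 5) = real (card Q)" and cQZ: "card Q + card Z + 4 = n"
      using w cardPQZ by auto
    have Q1: "card Q \<ge> 1" using w' 2 n5 by (metis mult_pos_pos of_nat_0_less_iff Suc_le_eq One_nat_def)
    have no3: "3 * \<omega> \<notin> {1, s}" if "card Q = 1"
    proof -
      have "(3 * \<omega>) * (real n - 5) = 3" using w' that by simp
      then show ?thesis by (rule ne)
    qed
    \<comment> \<open>One of \<open>U k\<close>, \<open>U l\<close> is at most
      \<open>- \<omega> / 2\<close>; together with two values \<open>\<omega> - 1\<close> it must
      stay above -1.\<close>
    have Q2: "3 * \<omega> \<ge> 2" if Q: "card Q \<ge> 2"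
    proof -
      obtain a b where ab: "a \<in> Q" "b \<in> Q" "a \<noteq> b" using card_ge_2_obtain[OF Q] by auto
      have "\<bar>U a + U b + U k\<bar> \<le> 1" "\<bar>U a + U b + U l\<bar> \<le> 1"
        using ab kl sub by (auto intro!: bd)
      then show ?thesis using ab UQ[OF ab(1)] UQ[OF ab(2)] Ukl by argo
    qed
    \<comment> \<open>\<open>Z0\<close> and \<open>Z3\<close> lead to the forbidden value
      \<open>3 / (n - 5)\<close>, and \<open>Z2\<close> contradicts \<open>n \<ge> 9\<close>. Only
      \<open>Z1\<close> survives, with \<open>\<omega> = 1\<close> and the single element of
      \<open>Z\<close> as exceptional point.\<close>
    consider (Z0) "card Z = 0" | (Z1) "card Z = 1" | (Z2) "card Z = 2" | (Z3) "card Z \<ge> 3" by linarith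
    then show ?thesis
    proof cases
      case Z0
      then have cQ: "real (card Q) = real n - 4" using cQZ by simp
      obtain a b c where abc: "a \<in> Q" "b \<in> Q" "c \<in> Q" "distinct [a,b,c]"
        using card_ge_3_obtain[of Q] cQ n by auto
      have "U a + U b + U c \<in> {0,1,-1,s,-s}" using abc sub by (intro triple) auto
      moreover have t: "(U a + U b + U c) * (real n - 5) = 3"
        using w' cQ unfolding UQ[OF abc(1)] UQ[OF abc(2)] UQ[OF abc(3)]
        by (simp add: algebra_simps)
      moreover have "U a + U b + U c > 0"
        using t n5 by (metis zero_less_mult_pos2 zero_less_numeral)
      ultimately show ?thesis using s ne[OF t] by auto
    next
      case Z1
      then have "real (card Q) = real n - 5" using cQZ by simp
      then have w1: "\<omega> = 1" using w' n5 by simp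
      obtain a where a: "a \<in> Z" using card_ge_1_obtain[of Z] Z1 by auto
      have "Q \<subseteq> insert k (insert l Y) - {a}" "card Q + 5 \<ge> n" using a sub dis cQZ Z1 by auto
      moreover have "U a = 1" "\<forall>c\<in>Q. U c = 0" "a \<in> Y" "\<omega> \<in> {0,1}"
        using UZ[OF a] UQ w1 a sub by auto
      ultimately show ?thesis by blast
    next
      case Z2
      obtain a b where ab: "a \<in> Z" "b \<in> Z" "a \<noteq> b" using card_ge_2_obtain[of Z] Z2 by auto
      obtain c where c: "c \<in> Q" using card_ge_1_obtain[OF Q1] by auto
      have "\<bar>U a + U b + U c\<bar> \<le> 1" using ab c sub dis by (intro bd) auto
      then have "3 * \<omega> \<le> 2" using ab c UZ UQ by force
      then have "3 * (\<omega> * (real n - 5)) \<le> 2 * (real n - 5)"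
        using n5 mult_right_mono[of "3*\<omega>" 2 "real n - 5"] by simp
      then show ?thesis using w' cQZ Z2 n by simp
    next
      case Z3
      obtain a b c where abc: "a \<in> Z" "b \<in> Z" "c \<in> Z" "distinct [a,b,c]"
        using card_ge_3_obtain[of Z] Z3 by auto
      have t: "3 * \<omega> \<in> {0,1,-1,s,-s}" using triple[of a b c] abc sub UZ by auto
      then have "3 * \<omega> \<le> 1" using s by auto
      then have "card Q = 1" using Q1 Q2 by force
      then show ?thesis using no3 t 2 s by auto
    qed
  next
    case 3
    then have PQ: "card P = card Q" using w by simp
    have P1: "card P \<le> 1"
    proof (rule ccontr)
      assume "\<not> card P \<le> 1"
      then obtain a b where ab: "a \<in> P" "b \<in> P" "a \<noteq> b" using card_ge_2_obtain[of P] by auto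
      show False
      proof (cases "card Z \<ge> 1")
        case True
        then obtain c where "c \<in> Z" using card_ge_1_obtain by auto
        then have "\<bar>U a + U b + U c\<bar> \<le> 1" using ab sub dis by (intro bd) auto
        then show False using UP UZ ab \<open>c \<in> Z\<close> 3 by force
      next
        case False
        then have "card P \<ge> 3" using PQ cardPQZ n by simp
        then obtain a b c where abc: "a \<in> P" "b \<in> P" "c \<in> P" "distinct [a,b,c]"
          using card_ge_3_obtain by blast
        then have "\<bar>U a + U b + U c\<bar> \<le> 1" using sub by (intro bd) auto
        then show False using UP abc 3 by force
      qed
    qed
    show ?thesis
    proof (cases "card P = 0")
      case True
      then have "P = {}" "Q = {}" using PQ finPQZ by auto
      then show ?thesis using 3 Yd by (auto simp: Z_def)
    next
      case False
      then have c1: "card P = 1" "card Q = 1" "card Z + 6 = n" using P1 PQ cardPQZ by auto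
      obtain a where a: "a \<in> P" using card_ge_1_obtain[of P] c1 by auto
      obtain z where z: "z \<in> Z" using card_ge_1_obtain[of Z] c1 n by auto
      have "\<bar>U a + U z + U k\<bar> \<le> 1" "\<bar>U a + U z + U l\<bar> \<le> 1"
        using a z kl sub dis by (auto intro!: bd)
      \<comment> \<open>Both values are at most 0, and they sum to
        \<open>- \<omega> = 0\<close>.\<close>
      then have k0: "U k = 0" "U l = 0" using UP[OF a] UZ[OF z] 3 Ukl by argo+
      have "card (insert k (insert l Z)) = card Z + 2" using kl sub finPQZ by (subst card_insert_disjoint; auto)+
      moreover have "insert k (insert l Z) \<subseteq> insert k (insert l Y) - {a}" using a kl sub dis by auto
      moreover have "U a = 1" "\<forall>c\<in>insert k (insert l Z). U c = 0" "a \<in> Y" "\<omega> \<in> {0,1}"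
        using 3 UP[OF a] UZ k0 a sub by auto
      moreover have "n \<le> card Z + 2 + 5" using c1 by simp
      ultimately show ?thesis by metis
    qed
  qed
qed

section \<open>Impossible splittings\<close>

text \<open>The locale describes the case \<open>\<beta>\<^sub>0 = \<gamma>\<^sub>2\<close>; neighbours of \<open>x\<close> are indexed by the pairs
  (removed point, added point).\<close>

locale johnson_split =
  fixes A :: "'a set" and n B b :: nat and X X' :: "'a set set"
  assumes finA: "finite A" and n: "card A = n" "n \<ge> 9"
    and X_sub: "x \<in> X \<union> X' \<Longrightarrow> x \<subseteq> A \<and> card x = 4"
    and disj: "X \<inter> X' = {}"
    and sep: "x \<in> X \<Longrightarrow> i \<in> x \<Longrightarrow> y \<in> A - x \<Longrightarrow> insert y (x - {i}) \<notin> X'"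
    and X_count: "x \<in> X \<Longrightarrow>
      card {p \<in> x \<times> (A - x). insert (snd p) (x - {fst p}) \<in> X} + 14 = 2 * n"
    and X'_count: "x \<in> X' \<Longrightarrow>
      card {p \<in> x \<times> (A - x). insert (snd p) (x - {fst p}) \<in> X'} + 14 = 2 * n"
    and mid_count: "x \<subseteq> A \<Longrightarrow> card x = 4 \<Longrightarrow> x \<notin> X \<Longrightarrow> x \<notin> X' \<Longrightarrow>
      card {p \<in> x \<times> (A - x). insert (snd p) (x - {fst p}) \<in> X} = b"
    and mid_count': "x \<subseteq> A \<Longrightarrow> card x = 4 \<Longrightarrow> x \<notin> X \<Longrightarrow> x \<notin> X' \<Longrightarrow>
      card {p \<in> x \<times> (A - x). insert (snd p) (x - {fst p}) \<in> X'} = B"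
    and bB: "1 \<le> b" "b \<le> B" "b + B + 4 = n"
    and X_ne: "X \<noteq> {}"
begin

definition f :: "'a set \<Rightarrow> real" where
  "f x = (if x \<in> X then real B else if x \<in> X' then - real b else 0)"

lemma sep':
  assumes "x \<in> X'" "i \<in> x" "y \<in> A - x" shows "insert y (x - {i}) \<notin> X"
proof
  assume X: "insert y (x - {i}) \<in> X"
  have "insert i (insert y (x - {i}) - {y}) = x" using assms by auto
  moreover have "i \<in> A - insert y (x - {i})" using assms X_sub[of x] by auto
  ultimately show False using sep[OF X, of y i] assms by auto
qed

lemma f_alt: "f x = real B * of_bool (x \<in> X) - real b * of_bool (x \<in> X')"
  using disj by (auto simp: f_def)

text \<open>\<open>2n - 14\<close> is the Johnson eigenvalue with index 2. At a middle vertex the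
  values \<open>B\<close> and \<open>- b\<close> occur \<open>b\<close> and \<open>B\<close> times
  and cancel; elsewhere only one of \<open>X\<close>, \<open>X'\<close> contributes.\<close>

lemma f_neighbour_sum:
  assumes x: "x \<subseteq> A" "card x = 4"
  shows "(\<Sum>i\<in>x. \<Sum>y\<in>A - x. f (insert y (x - {i}))) = (2 * real n - 14) * f x"
proof -
  define c where "c S = card {p \<in> x \<times> (A - x). insert (snd p) (x - {fst p}) \<in> S}" for S
  have fx: "finite x" using x card_ge_0_finite by force
  have fin: "finite (x \<times> (A - x))" using fx finA by auto
  have sc: "(\<Sum>p\<in>x \<times> (A - x). of_bool (insert (snd p) (x - {fst p}) \<in> S)) = real (c S)" for S
    using fin by (simp add: c_def Int_def conj_commute)
  have "(\<Sum>i\<in>x. \<Sum>y\<in>A - x. f (insert y (x - {i}))) = (\<Sum>p\<in>x \<times> (A - x). f (insert (snd p) (x - {fst p})))"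
    by (simp add: sum.cartesian_product split_def)
  also have "\<dots> = real B * real (c X) - real b * real (c X')"
    by (simp only: f_alt sum_subtractf sum_distrib_left[symmetric] sc)
  also have "\<dots> = (2 * real n - 14) * f x"
  proof -
    consider "x \<in> X" | "x \<in> X'" | "x \<notin> X" "x \<notin> X'" by blast
    then show ?thesis
    proof cases
      case 1
      have "{p \<in> x \<times> (A - x). insert (snd p) (x - {fst p}) \<in> X'} = {}"
        using sep[OF 1] by auto
      then have "c X' = 0" by (simp only: c_def card.empty)
      moreover have "real (c X) = 2 * real n - 14" using X_count[OF 1] by (simp add: c_def)
      ultimately show ?thesis using 1 by (simp add: f_def)
    next
      case 2
      have "{p \<in> x \<times> (A - x). insert (snd p) (x - {fst p}) \<in> X} = {}"
        using sep'[OF 2] by auto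
      then have "c X = 0" by (simp only: c_def card.empty)
      moreover have "real (c X') = 2 * real n - 14" using X'_count[OF 2] by (simp add: c_def)
      ultimately show ?thesis using 2 disj by (auto simp: f_def)
    next
      case 3
      then have "c X = b" "c X' = B" using mid_count[OF x] mid_count'[OF x] by (auto simp: c_def)
      then show ?thesis using 3 by (simp add: f_def)
    qed
  qed
  finally show ?thesis .
qed

end

section \<open>Pair weights and the rows of neighbours around a vertex of \<open>X\<close>\<close>

locale johnson_split_weights = johnson_split +
  fixes g :: "'a \<Rightarrow> 'a \<Rightarrow> real"
  assumes g_sym: "g i j = g j i"
    and g3: "{i,j,k} \<subseteq> A \<Longrightarrow> distinct [i,j,k] \<Longrightarrow>
      (\<Sum>y\<in>A - {i,j,k}. f (insert y {i,j,k})) = (real n - 5) * (g i j + g i k + g j k)"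
    and g4: "{i,j,k,l} \<subseteq> A \<Longrightarrow> distinct [i,j,k,l] \<Longrightarrow>
      f {i,j,k,l} = g i j + g i k + g i l + g j k + g j l + g k l"
begin

definition m :: "'a set \<Rightarrow> nat" where "m T = card {y \<in> A - T. insert y T \<in> X}"

text \<open>Division by \<open>B\<close> turns the possible jumps of \<open>f\<close> between
  neighbours into 0, \<plusminus>1 and \<plusminus>\<open>s\<close>.\<close>

definition u :: "'a \<Rightarrow> 'a \<Rightarrow> 'a \<Rightarrow> real" where "u i j y = (g i y - g j y) / B"

definition s :: real where "s = b / B"

lemma B_pos: "real B > 0" using bB by simp

lemma s_bounds: "0 < s" "s \<le> 1" using bB by (auto simp: s_def)

text \<open>Equality means \<open>b (n - 2) = 3 (n - 4)\<close>, which forces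
  \<open>b \<le> 2\<close> and then \<open>n \<le> 8\<close>.\<close>

lemma s_ne: "s * (real n - 5) \<noteq> 3"
proof
  assume "s * (real n - 5) = 3"
  then have "real b * (real n - 5) = 3 * real B" using B_pos by (simp add: s_def field_simps)
  then have e: "real b * (real n - 2) = 3 * (real n - 2) - 6" using bB(3) by (simp add: algebra_simps)
  then have "real b * (real n - 2) < 3 * (real n - 2)" by simp
  then have "real b < 3" by (rule mult_right_less_imp_less) (use n in simp)
  then have "real b \<le> 2" by simp
  then have "real b * (real n - 2) \<le> 2 * (real n - 2)" using n by (intro mult_right_mono) auto
  then show False using e n by simp
qed

lemma u_triple_eq:
  assumes "{i,j,a,c,e} \<subseteq> A" "distinct [i,j,a,c,e]"
  shows "real B * (u i j a + u i j c + u i j e) = f {i,a,c,e} - f {j,a,c,e}"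
proof -
  have "f {i,a,c,e} = g i a + g i c + g i e + g a c + g a e + g c e"
       "f {j,a,c,e} = g j a + g j c + g j e + g a c + g a e + g c e"
    using assms by (auto intro!: g4)
  moreover have "real B * (u i j a + u i j c + u i j e) = (g i a - g j a) + (g i c - g j c) + (g i e - g j e)"
    using B_pos by (simp add: u_def distrib_left)
  ultimately show ?thesis by simp
qed

text \<open>The triple sum compares two adjacent vertices, and \<open>sep\<close> rules out the jump
  \<open>B + b\<close> between \<open>X\<close> and \<open>X'\<close>.\<close>

lemma u_triple:
  assumes "{i,j,a,c,e} \<subseteq> A" "distinct [i,j,a,c,e]"
  shows "u i j a + u i j c + u i j e \<in> {0,1,-1,s,-s}"
proof -
  have sw: "insert q ({p,a,c,e} - {p}) = {q,a,c,e}" if "p \<notin> {a,c,e}" for p q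
    using that by auto
  have no: "\<not> ({p,a,c,e} \<in> X \<and> {q,a,c,e} \<in> X')" if "p \<noteq> q" "{p,q} \<subseteq> A - {a,c,e}" for p q
    using sep[of "{p,a,c,e}" p q] that sw[of p q] by auto
  have "f {i,a,c,e} - f {j,a,c,e} \<in> {0, real B, - real B, real b, - real b}"
    using no[of i j] no[of j i] assms by (auto simp: f_def)
  then have "real B * (u i j a + u i j c + u i j e) \<in> {0, real B, - real B, real b, - real b}"
    unfolding u_triple_eq[OF assms] .
  moreover have "t \<in> {0,1,-1,s,-s}" if r: "r \<in> {0, real B, - real B, real b, - real b}" "real B * t = r" for r t
  proof -
    have "t = r / real B" using r(2) B_pos by (simp add: field_simps)
    then show ?thesis using r(1) B_pos by (auto simp: s_def)
  qed
  ultimately show ?thesis by blast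
qed

text \<open>Every superset of the triple equals or is adjacent to a vertex of \<open>X\<close>,
  hence avoids \<open>X'\<close>; so the sum in \<open>g3\<close> merely counts members of
  \<open>X\<close>.\<close>

lemma m_weights:
  assumes x: "{i,j,k,l} \<in> X" and d: "distinct [i,j,k,l]"
  shows "real B * real (m {j,k,l}) = (real n - 5) * (g j k + g j l + g k l)"
    and "m {j,k,l} = Suc (card {y \<in> A - {i,j,k,l}. insert y {j,k,l} \<in> X})"
proof -
  have sub: "{i,j,k,l} \<subseteq> A" using X_sub[of "{i,j,k,l}"] x by blast
  have fX: "f (insert y {j,k,l}) = real B * of_bool (insert y {j,k,l} \<in> X)" if "y \<in> A - {j,k,l}" for y
  proof (cases "y = i")
    case False
    have "{i,j,k,l} - {i} = {j,k,l}" using d by auto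
    then have "insert y {j,k,l} \<notin> X'" using sep[OF x, of i y] that False by auto
    then show ?thesis by (simp add: f_def)
  qed (use x in \<open>simp add: f_def\<close>)
  have "(\<Sum>y\<in>A - {j,k,l}. f (insert y {j,k,l})) = real B * (\<Sum>y\<in>A - {j,k,l}. of_bool (insert y {j,k,l} \<in> X))"
    unfolding sum_distrib_left by (intro sum.cong refl fX)
  also have "(\<Sum>y\<in>A - {j,k,l}. of_bool (insert y {j,k,l} \<in> X)) = real (m {j,k,l})"
    using finA by (simp add: m_def Int_def conj_commute)
  finally show "real B * real (m {j,k,l}) = (real n - 5) * (g j k + g j l + g k l)"
    using g3[of j k l] sub d by simp
  have "{y \<in> A - {j,k,l}. insert y {j,k,l} \<in> X} = insert i {y \<in> A - {i,j,k,l}. insert y {j,k,l} \<in> X}"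
    using x sub d by auto
  then show "m {j,k,l} = Suc (card {y \<in> A - {i,j,k,l}. insert y {j,k,l} \<in> X})"
    using finA by (simp add: m_def)
qed

text \<open>Summing \<open>m_weights\<close> over the four triples uses every pair weight twice, and
  the six pair weights add up to \<open>f {i,j,k,l} = B\<close>.\<close>

lemma m_sum:
  assumes x: "{i,j,k,l} \<in> X" and d: "distinct [i,j,k,l]"
  shows "m {j,k,l} + m {i,k,l} + m {i,j,l} + m {i,j,k} + 10 = 2 * n"
proof -
  have sub: "{i,j,k,l} \<subseteq> A" using X_sub[of "{i,j,k,l}"] x by blast
  have "real B = g i j + g i k + g i l + g j k + g j l + g k l"
    using g4[OF sub d] x by (simp add: f_def)
  moreover have "{j,i,k,l} = {i,j,k,l}" "{k,i,j,l} = {i,j,k,l}" "{l,i,j,k} = {i,j,k,l}" by auto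
  then have "real B * real (m {j,k,l}) = (real n - 5) * (g j k + g j l + g k l)"
      "real B * real (m {i,k,l}) = (real n - 5) * (g i k + g i l + g k l)"
      "real B * real (m {i,j,l}) = (real n - 5) * (g i j + g i l + g j l)"
      "real B * real (m {i,j,k}) = (real n - 5) * (g i j + g i k + g j k)"
    using m_weights(1)[of i j k l] m_weights(1)[of j i k l] m_weights(1)[of k i j l]
      m_weights(1)[of l i j k] x d by auto
  ultimately have "real B * (real (m {j,k,l}) + real (m {i,k,l}) + real (m {i,j,l}) + real (m {i,j,k})) =
      real B * (2 * (real n - 5))"
    by (simp add: algebra_simps)
  then have "real (m {j,k,l}) + real (m {i,k,l}) + real (m {i,j,l}) + real (m {i,j,k}) = 2 * (real n - 5)"
    using B_pos by simp
  then have "real (m {j,k,l} + m {i,k,l} + m {i,j,l} + m {i,j,k} + 10) = real (2 * n)" by simp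
  then show ?thesis by (simp only: of_nat_eq_iff)
qed

text \<open>Captures the second alternative of \<open>triple_sum_classification\<close>: besides the
  value 1 at \<open>a\<close>, at most two of the remaining \<open>n - 3\<close> points have a
  nonzero difference.\<close>

definition outlier :: "'a \<Rightarrow> 'a \<Rightarrow> bool" where
  "outlier i j \<longleftrightarrow> (\<exists>a M. a \<in> A - {i,j} \<and> u i j a = 1 \<and> M \<subseteq> A - {i,j,a} \<and>
     card M + 5 \<ge> n \<and> (\<forall>c\<in>M. u i j c = 0))"

text \<open>The classification is applied to \<open>u i j\<close>; \<open>\<omega> = 0\<close> means
  equal row counts and \<open>\<omega> = 1\<close> a difference of \<open>n - 5\<close>.\<close>

lemma rows:
  assumes x: "{i,j,k,l} \<in> X" and d: "distinct [i,j,k,l]" and le: "m {i,k,l} \<le> m {j,k,l}"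
  shows "m {j,k,l} = m {i,k,l} \<and> (\<forall>y\<in>A - {i,j,k,l}. u i j y = 0 \<and>
      ({y,i,k,l} \<in> X \<longleftrightarrow> {y,j,k,l} \<in> X)) \<or>
    (m {j,k,l} = m {i,k,l} \<or> m {j,k,l} + 5 = m {i,k,l} + n) \<and> outlier i j"
proof -
  have sub: "{i,j,k,l} \<subseteq> A" using X_sub[of "{i,j,k,l}"] x by blast
  have x': "{j,i,k,l} \<in> X" using x by (simp add: insert_commute)
  have d': "distinct [j,i,k,l]" using d by auto
  define Y where "Y = A - {i,j,k,l}"
  define \<omega> where "\<omega> = (real (m {j,k,l}) - real (m {i,k,l})) / (real n - 5)"
  define \<delta> :: "'a \<Rightarrow> int" where
    "\<delta> y = of_bool ({y,i,k,l} \<in> X) - of_bool ({y,j,k,l} \<in> X)" for y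
  have n5: "real n - 5 > 0" using n by simp
  have finY: "finite Y" using finA by (simp add: Y_def)
  have cardY: "card Y + 4 = n"
    unfolding Y_def using card_Diff_subset[OF _ sub] n d by simp
  have insY: "insert k (insert l Y) = A - {i,j}" using sub d by (auto simp: Y_def)
  \<comment> \<open>Subtracting the two instances of \<open>m_weights\<close> cancels
    \<open>g k l\<close> and leaves exactly the differences at \<open>k\<close> and
    \<open>l\<close>.\<close>
  have kl: "u i j k + u i j l = - \<omega>"
  proof -
    have "real B * real (m {j,k,l}) - real B * real (m {i,k,l}) =
        - ((real n - 5) * ((g i k - g j k) + (g i l - g j l)))"
      using m_weights(1)[OF x d] m_weights(1)[OF x' d'] by (simp add: algebra_simps)
    moreover have "\<omega> * (real n - 5) = real (m {j,k,l}) - real (m {i,k,l})"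
      using n5 by (simp add: \<omega>_def)
    ultimately have "real B * (\<omega> * (real n - 5)) = - (real B * ((real n - 5) * (u i j k + u i j l)))"
      using B_pos by (simp add: u_def right_diff_distrib flip: add_divide_distrib)
    then have "real B * (real n - 5) * \<omega> = real B * (real n - 5) * (- (u i j k + u i j l))"
      by (simp add: algebra_simps)
    then show ?thesis using n5 B_pos by simp
  qed
  have fX: "f {y,p,k,l} = real B * of_bool ({y,p,k,l} \<in> X)" if "y \<in> Y" "p = i \<or> p = j" for y p
  proof -
    have "{i,j,k,l} - {i} = {j,k,l}" "{i,j,k,l} - {j} = {i,k,l}" using d by auto
    then have "{y,p,k,l} \<notin> X'" using sep[OF x, of i y] sep[OF x, of j y] that by (auto simp: Y_def)
    then show ?thesis by (simp add: f_def)
  qed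
  have U: "u i j y = \<omega> + real_of_int (\<delta> y)" if y: "y \<in> Y" for y
  proof -
    have "real B * (u i j y + u i j k + u i j l) = f {i,y,k,l} - f {j,y,k,l}"
      using y sub d by (intro u_triple_eq) (auto simp: Y_def)
    also have "\<dots> = f {y,i,k,l} - f {y,j,k,l}" by (simp add: insert_commute)
    also have "\<dots> = real B * real_of_int (\<delta> y)" using fX[OF y] by (simp add: \<delta>_def right_diff_distrib)
    finally show ?thesis using kl B_pos by simp
  qed
  have \<delta>_sum: "(\<Sum>y\<in>Y. \<delta> y) = int (m {i,k,l}) - int (m {j,k,l})"
  proof -
    have "(\<Sum>y\<in>Y. \<delta> y) = int (card {y\<in>Y. {y,i,k,l} \<in> X}) - int (card {y\<in>Y. {y,j,k,l} \<in> X})"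
      using finY by (simp add: \<delta>_def sum_subtractf Int_def conj_commute)
    moreover have "{j,i,k,l} = {i,j,k,l}" by auto
    ultimately show ?thesis using m_weights(2)[OF x d] m_weights(2)[OF x' d'] by (simp add: Y_def)
  qed
  have "\<omega> = 0 \<and> (\<forall>y\<in>Y. \<delta> y = 0) \<or>
    \<omega> \<in> {0,1} \<and> (\<exists>a M. a \<in> Y \<and> u i j a = 1 \<and> M \<subseteq> insert k (insert l Y) - {a} \<and> card M + 5 \<ge> n \<and>
      (\<forall>c\<in>M. u i j c = 0))"
  proof (rule triple_sum_classification[OF finY cardY n(2) _ _ _ U _ kl _ _ s_bounds s_ne])
    show "u i j a + u i j c + u i j e \<in> {0,1,-1,s,-s}"
      if "{a,c,e} \<subseteq> insert k (insert l Y)" "distinct [a,c,e]" for a c e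
      using that sub d unfolding insY by (intro u_triple) auto
    show "\<omega> * (real n - 5) = - real_of_int (\<Sum>y\<in>Y. \<delta> y)" using n5 by (simp add: \<omega>_def \<delta>_sum)
    show "\<omega> \<ge> 0" using le n5 by (simp add: \<omega>_def)
  qed (use d in \<open>auto simp: Y_def \<delta>_def\<close>)
  moreover have w0: "m {j,k,l} = m {i,k,l}" if "\<omega> = 0" using that n5 by (simp add: \<omega>_def)
  moreover have w1: "m {j,k,l} + 5 = m {i,k,l} + n" if "\<omega> = 1"
    using that n5 by (simp add: \<omega>_def field_simps)
  ultimately show ?thesis
  proof (elim disjE conjE exE)
    assume w: "\<omega> = 0" and "\<forall>y\<in>Y. \<delta> y = 0"
    then have d0: "\<delta> y = 0" if "y \<in> Y" for y using that by blast
    have "u i j y = 0 \<and> ({y,i,k,l} \<in> X \<longleftrightarrow> {y,j,k,l} \<in> X)" if "y \<in> Y" for y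
      using U[OF that] d0[OF that] w
      by (cases "{y,i,k,l} \<in> X"; cases "{y,j,k,l} \<in> X") (simp_all add: \<delta>_def)
    then show ?thesis using w0[OF w] unfolding Y_def by blast
  next
    fix a M
    assume "\<omega> \<in> {0,1}" and M: "a \<in> Y" "u i j a = 1" "M \<subseteq> insert k (insert l Y) - {a}"
      "card M + 5 \<ge> n" "\<forall>c\<in>M. u i j c = 0"
    have "M \<subseteq> A - {i,j,a}" using M(3) unfolding insY by blast
    moreover have "a \<in> A - {i,j}" using M(1) by (simp add: Y_def)
    ultimately have "outlier i j" unfolding outlier_def using M by blast
    then show ?thesis using \<open>\<omega> \<in> {0,1}\<close> w0 w1 by blast
  qed
qed

end

section \<open>Parity of \<open>n\<close>, absence of outliers, and equality of rows\<close>

context johnson_split_weights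
begin

lemma four_elems:
  assumes "x \<in> X" "i \<in> x" "j \<in> x" "i \<noteq> j"
  obtains k l where "x = {i,j,k,l}" "distinct [i,j,k,l]"
proof -
  have "card (x - {i} - {j}) = 2"
    using X_sub[of x] assms by (simp add: card.insert_remove card_Diff_singleton)
  then obtain k l where kl: "x - {i} - {j} = {k,l}" "k \<noteq> l" unfolding card_2_iff by blast
  have "k \<in> x - {i} - {j}" "l \<in> x - {i} - {j}" unfolding kl by auto
  then have d: "distinct [i,j,k,l]" using assms kl(2) by auto
  have "x = insert i (insert j (x - {i} - {j}))" using assms by auto
  then have "x = {i,j,k,l}" unfolding kl .
  then show thesis using d that by blast
qed

lemma m_dichotomy:
  assumes x: "{i,j,k,l} \<in> X" and d: "distinct [i,j,k,l]"
  shows "m {j,k,l} = m {i,k,l} \<or> m {j,k,l} + 5 = m {i,k,l} + n \<or> m {i,k,l} + 5 = m {j,k,l} + n"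
proof -
  have x': "{j,i,k,l} \<in> X" using x by (simp add: insert_commute)
  have d': "distinct [j,i,k,l]" using d by auto
  show ?thesis
  proof (cases "m {i,k,l} \<le> m {j,k,l}")
    case True
    then show ?thesis using rows[OF x d] by argo
  next
    case False
    then have "m {j,k,l} \<le> m {i,k,l}" by simp
    then show ?thesis using rows[OF x' d'] by argo
  qed
qed

text \<open>The four counts are positive, differ from the first by 0 or \<open>n - 5\<close>, and
  sum to \<open>2 (n - 5)\<close>. Hence all are \<open>(n - 5) / 2\<close>, or three are
  \<open>(n - 5) / 4\<close> and the fourth is larger by \<open>n - 5\<close>.\<close>

lemma m_profile:
  assumes x: "{i,j,k,l} \<in> X" and d: "distinct [i,j,k,l]"
  shows "odd n" and "2 * m {j,k,l} + 5 \<le> n \<or> 2 * m {i,k,l} + 5 \<le> n"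
proof -
  have e: "{i,k,j,l} = {i,j,k,l}" "{i,l,j,k} = {i,j,k,l}" "{k,j,l} = {j,k,l}" "{l,j,k} = {j,k,l}"
    by auto
  have pos: "m {j,k,l} \<ge> 1" "m {i,k,l} \<ge> 1" "m {i,j,l} \<ge> 1" "m {i,j,k} \<ge> 1"
  proof -
    have "{j,i,k,l} = {i,j,k,l}" "{k,i,j,l} = {i,j,k,l}" "{l,i,j,k} = {i,j,k,l}" by auto
    then show "m {j,k,l} \<ge> 1" "m {i,k,l} \<ge> 1" "m {i,j,l} \<ge> 1" "m {i,j,k} \<ge> 1"
      using m_weights(2)[of i j k l] m_weights(2)[of j i k l] m_weights(2)[of k i j l]
      m_weights(2)[of l i j k] x d by auto
  qed
  have 1: "m {j,k,l} = m {i,k,l} \<or> m {j,k,l} + 5 = m {i,k,l} + n \<or> m {i,k,l} + 5 = m {j,k,l} + n"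
    by (rule m_dichotomy[OF x d])
  have 2: "m {j,k,l} = m {i,j,l} \<or> m {j,k,l} + 5 = m {i,j,l} + n \<or> m {i,j,l} + 5 = m {j,k,l} + n"
    using m_dichotomy[of i k j l] x d unfolding e by auto
  have 3: "m {j,k,l} = m {i,j,k} \<or> m {j,k,l} + 5 = m {i,j,k} + n \<or> m {i,j,k} + 5 = m {j,k,l} + n"
    using m_dichotomy[of i l j k] x d unfolding e by auto
  have arith: "odd n \<and> (2 * p + 5 \<le> n \<or> 2 * q + 5 \<le> n)"
    if "p = q \<or> p + 5 = q + n \<or> q + 5 = p + n" "p = r \<or> p + 5 = r + n \<or> r + 5 = p + n"
      "p = t \<or> p + 5 = t + n \<or> t + 5 = p + n" "p + q + r + t + 10 = 2 * n"
      "p \<ge> 1" "q \<ge> 1" "r \<ge> 1" "t \<ge> 1" for p q r t :: nat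
  proof -
    \<comment> \<open>In order: all counts agree, \<open>p\<close> is the large one, or one of
      \<open>q\<close>, \<open>r\<close>, \<open>t\<close> is.\<close>
    have "n = 2 * p + 5 \<or> n = 4 * q + 5 \<or> n = 4 * p + 5"
      using that n(2)
      by (elim disjE) ((rule disjI1, linarith) | (rule disjI2, rule disjI1, linarith)
        | (rule disjI2, rule disjI2, linarith))+
    then show ?thesis by (elim disjE) simp_all
  qed
  show "odd n" "2 * m {j,k,l} + 5 \<le> n \<or> 2 * m {i,k,l} + 5 \<le> n"
    using arith[OF 1 2 3 m_sum[OF x d] pos] by auto
qed

text \<open>By \<open>m_profile\<close> the sum \<open>b + B = n - 4\<close> is odd.\<close>

lemma b_less_B: "b < B"
proof -
  obtain x where x: "x \<in> X" using X_ne by blast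
  then have "card x \<ge> 2" using X_sub by auto
  then obtain i j where ij: "i \<in> x" "j \<in> x" "i \<noteq> j" using card_ge_2_obtain by blast
  obtain k l where "x = {i,j,k,l}" "distinct [i,j,k,l]" using four_elems[OF x ij] .
  then have odd: "odd n" using m_profile(1) x by blast
  have "b \<noteq> B"
  proof
    assume "b = B"
    then have "n = 2 * (b + 2)" using bB(3) by simp
    then show False using odd by simp
  qed
  then show ?thesis using bB(2) by simp
qed

lemma no_outlier:
  assumes ij: "i \<in> A" "j \<in> A" "i \<noteq> j" shows "\<not> outlier i j"
proof
  assume "outlier i j"
  then obtain a M where a: "a \<in> A - {i,j}" "u i j a = 1" and M: "M \<subseteq> A - {i,j,a}"
    "card M + 5 \<ge> n" "\<And>c. c \<in> M \<Longrightarrow> u i j c = 0" unfolding outlier_def by blast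
  have finM: "finite M" using M finA finite_subset by blast
  \<comment> \<open>The jump of \<open>f\<close> is exactly \<open>B\<close>. A jump from
    \<open>X'\<close> to a middle vertex is only \<open>b < B\<close>, so the upper end lies in
    \<open>X\<close>.\<close>
  have inX: "{i,a,c,e} \<in> X" if "c \<in> M" "e \<in> M" "c \<noteq> e" for c e
  proof -
    have "real B * (u i j a + u i j c + u i j e) = f {i,a,c,e} - f {j,a,c,e}"
      using that M(1) a ij by (intro u_triple_eq) auto
    then have "f {i,a,c,e} - f {j,a,c,e} = real B" using that M(3) a by simp
    then show ?thesis using b_less_B bB by (auto simp: f_def split: if_splits)
  qed
  have big: "m {i,a,c} + 6 \<ge> n" if "c \<in> M" for c
  proof -
    have "M - {c} \<subseteq> {y \<in> A - {i,a,c}. insert y {i,a,c} \<in> X}"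
    proof
      fix y assume y: "y \<in> M - {c}"
      then have "insert y {i,a,c} \<in> X" using inX[of c y] that by (auto simp: insert_commute)
      then show "y \<in> {y \<in> A - {i,a,c}. insert y {i,a,c} \<in> X}" using y M(1) by auto
    qed
    then have "card (M - {c}) \<le> m {i,a,c}" unfolding m_def using finA by (intro card_mono) auto
    then show ?thesis using M(2) finM that by (simp add: card_Diff_singleton)
  qed
  have "card M \<ge> 2" using M(2) n by simp
  then obtain c e where ce: "c \<in> M" "e \<in> M" "c \<noteq> e" using card_ge_2_obtain by blast
  \<comment> \<open>Both triples \<open>{i,a,c}\<close> and \<open>{i,a,e}\<close> have at least
    \<open>n - 6\<close> extensions in \<open>X\<close>, whereas \<open>m_profile\<close> allows one
    of them at most \<open>(n - 5) / 2\<close>.\<close>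
  have "{c,e,i,a} \<in> X" using inX[OF ce] by (simp add: insert_commute)
  moreover have "distinct [c,e,i,a]" using ce M(1) a ij by auto
  ultimately have "2 * m {e,i,a} + 5 \<le> n \<or> 2 * m {c,i,a} + 5 \<le> n" by (rule m_profile(2))
  moreover have "{e,i,a} = {i,a,e}" "{c,i,a} = {i,a,c}" by auto
  ultimately show False using big[OF ce(1)] big[OF ce(2)] n by auto
qed

text \<open>With outliers excluded only the first alternative of \<open>rows\<close> remains,
  whichever of the two counts is larger.\<close>

lemma rows_eq:
  assumes x: "{i,j,k,l} \<in> X" and d: "distinct [i,j,k,l]"
  shows "m {j,k,l} = m {i,k,l}"
    and "y \<in> A - {i,j,k,l} \<Longrightarrow> g i y = g j y"
    and "y \<in> A - {i,j,k,l} \<Longrightarrow> {y,i,k,l} \<in> X \<longleftrightarrow> {y,j,k,l} \<in> X"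
proof -
  have x': "{j,i,k,l} \<in> X" using x by (simp add: insert_commute)
  have d': "distinct [j,i,k,l]" using d by auto
  have sub: "{i,j,k,l} \<subseteq> A" using X_sub[of "{i,j,k,l}"] x by blast
  have "\<not> outlier i j" "\<not> outlier j i" using no_outlier sub d by auto
  then have "m {j,k,l} = m {i,k,l} \<and> (\<forall>y\<in>A - {i,j,k,l}. (u i j y = 0 \<or> u j i y = 0) \<and>
      ({y,i,k,l} \<in> X \<longleftrightarrow> {y,j,k,l} \<in> X))"
    using rows[OF x d] rows[OF x' d'] unfolding insert_commute[of j i "{k,l}"]
    by (cases "m {i,k,l} \<le> m {j,k,l}") auto
  moreover have "g i y = g j y" if "u i j y = 0 \<or> u j i y = 0" for y
    using that B_pos by (auto simp: u_def)
  ultimately have "m {j,k,l} = m {i,k,l} \<and> (\<forall>y\<in>A - {i,j,k,l}. g i y = g j y \<and>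
      ({y,i,k,l} \<in> X \<longleftrightarrow> {y,j,k,l} \<in> X))" by blast
  then show "m {j,k,l} = m {i,k,l}"
    "y \<in> A - {i,j,k,l} \<Longrightarrow> g i y = g j y"
    "y \<in> A - {i,j,k,l} \<Longrightarrow> {y,i,k,l} \<in> X \<longleftrightarrow> {y,j,k,l} \<in> X" by auto
qed

text \<open>Any two rows agree by \<open>rows_eq\<close>, so the neighbours in \<open>X\<close> fill
  whole columns of the grid.\<close>

lemma column_eq:
  assumes "x \<in> X" "i \<in> x" "j \<in> x" "y \<in> A - x" "insert y (x - {i}) \<in> X"
  shows "insert y (x - {j}) \<in> X"
proof (cases "i = j")
  case False
  obtain k l where kl: "x = {i,j,k,l}" "distinct [i,j,k,l]" using four_elems[OF assms(1-3) False] .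
  have "x - {i} = {j,k,l}" "x - {j} = {i,k,l}" using kl by auto
  then show ?thesis using rows_eq(3)[of i j k l y] kl assms by simp
qed (use assms in simp)

text \<open>The four equal counts sum to \<open>2n - 10\<close>, and each includes \<open>x\<close>
  itself, which leaves \<open>(n - 5) / 2 - 1\<close> columns.\<close>

lemma column_card:
  assumes "x \<in> X" "i \<in> x"
  shows "2 * card {y \<in> A - x. insert y (x - {i}) \<in> X} + 7 = n"
proof -
  have "card (x - {i}) \<ge> 1" using X_sub[of x] assms by (simp add: card_Diff_singleton)
  then obtain j where j: "j \<in> x" "i \<noteq> j" using card_ge_1_obtain by blast
  obtain k l where kl: "x = {i,j,k,l}" "distinct [i,j,k,l]" using four_elems[OF assms j] .
  have x: "{i,j,k,l} \<in> X" "{i,k,j,l} \<in> X" "{i,l,j,k} \<in> X" using assms(1) kl by (auto simp: insert_commute)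
  have "m {j,k,l} = m {i,k,l}" "m {k,j,l} = m {i,j,l}" "m {l,j,k} = m {i,j,k}"
    using x kl(2) rows_eq(1)[of i j k l] rows_eq(1)[of i k j l] rows_eq(1)[of i l j k] by auto
  moreover have "{k,j,l} = {j,k,l}" "{l,j,k} = {j,k,l}" by auto
  ultimately have "4 * m {j,k,l} + 10 = 2 * n" using m_sum[OF x(1) kl(2)] by simp
  moreover have "x - {i} = {j,k,l}" using kl by auto
  ultimately show ?thesis using m_weights(2)[OF x(1) kl(2)] kl(1) by simp
qed

text \<open>Exchanging twins preserves \<open>f\<close>.\<close>

definition twin :: "'a \<Rightarrow> 'a \<Rightarrow> bool" where
  "twin i j \<longleftrightarrow> i = j \<or> (\<forall>y\<in>A - {i,j}. g i y = g j y)"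

lemma twin_sym: "twin i j \<Longrightarrow> twin j i"
  unfolding twin_def by (metis insert_commute)

lemma twin_trans:
  assumes "twin i j" "twin j k" "i \<in> A" "j \<in> A" "k \<in> A"
  shows "twin i k"
proof (cases "i = j \<or> j = k \<or> i = k")
  case False
  have ij: "g i y = g j y" if "y \<in> A - {i,j}" for y using assms False that by (auto simp: twin_def)
  have jk: "g j y = g k y" if "y \<in> A - {j,k}" for y using assms False that by (auto simp: twin_def)
  have "g i y = g k y" if y: "y \<in> A - {i,k}" for y
  proof (cases "y = j")
    case True
    \<comment> \<open>By symmetry of \<open>g\<close>, both \<open>g i j\<close> and
      \<open>g k j\<close> equal \<open>g i k\<close>.\<close>
    then show ?thesis using ij[of k] jk[of i] g_sym assms False by (metis Diff_iff insert_iff empty_iff)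
  next
    case False
    then show ?thesis using ij[of y] jk[of y] y by auto
  qed
  then show ?thesis by (auto simp: twin_def)
qed (use assms in \<open>auto simp: twin_def\<close>)

lemma twin_in_X:
  assumes x: "x \<in> X" "i \<in> x" "j \<in> x" shows "twin i j"
proof (cases "i = j")
  case False
  obtain k l where kl: "x = {i,j,k,l}" "distinct [i,j,k,l]" using four_elems[OF x False] .
  have out: "g i y = g j y" if "z \<in> X" "i \<in> z" "j \<in> z" "y \<in> A - z" for y z
    using that False four_elems rows_eq(2) by metis
  have "g i y = g j y" if y: "y \<in> A - {i,j}" for y
  proof (cases "y \<in> x")
    case True
    \<comment> \<open>\<open>rows_eq\<close> speaks of points outside the vertex; replacing
      \<open>y\<close> by a point \<open>w\<close> of a full column moves \<open>y\<close> outside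
      while keeping \<open>i\<close> and \<open>j\<close>.\<close>
    have "card {w \<in> A - x. insert w (x - {y}) \<in> X} \<ge> 1" using column_card[OF x(1) True] n by simp
    then obtain w where w: "w \<in> A - x" "insert w (x - {y}) \<in> X" using card_ge_1_obtain by blast
    show ?thesis using w x y True by (intro out[OF w(2)]) auto
  qed (use y x out in auto)
  then show ?thesis by (auto simp: twin_def)
qed (simp add: twin_def)

text \<open>A full column \<open>y\<close> puts \<open>y\<close> and \<open>i\<close> into a common
  member of \<open>X\<close>. Conversely, exchanging a point of \<open>x\<close> for a twin keeps
  the value \<open>B\<close> of \<open>f\<close>, which only members of \<open>X\<close> attain. The
  size is \<open>4 + (n - 7) / 2\<close>.\<close>

lemma twin_class:
  assumes x: "x \<in> X" "i \<in> x"
  shows "{y \<in> A. twin i y} = x \<union> {y \<in> A - x. insert y (x - {i}) \<in> X}"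
    and "2 * card {y \<in> A. twin i y} = n + 1"
proof -
  have xA: "x \<subseteq> A" "card x = 4" "finite x" using X_sub[of x] x finA finite_subset by auto
  have "card (x - {i}) \<ge> 1" using xA x by (simp add: card_Diff_singleton)
  then obtain k where k: "k \<in> x" "k \<noteq> i" using card_ge_1_obtain by blast
  have 1: "twin i y" if "y \<in> A - x" "insert y (x - {i}) \<in> X" for y
  proof -
    have "insert y (x - {k}) \<in> X" using column_eq[OF x k(1) that] .
    then show ?thesis using twin_in_X[of _ i y] x k by auto
  qed
  have 2: "insert y (x - {i}) \<in> X" if y: "y \<in> A - x" "twin i y" for y
  proof -
    obtain p q where pq: "x = {k,i,p,q}" "distinct [k,i,p,q]" using four_elems[OF x(1) k(1) x(2) k(2)] .
    have "twin k y" using twin_trans[OF twin_in_X[OF x(1) k(1) x(2)] y(2)] xA k x y by auto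
    then have t: "g k w = g y w" if "w \<in> {i,p,q}" for w
      using that pq y xA by (auto simp: twin_def)
    have "f {k,i,p,q} = f {y,i,p,q}"
      using g4[of k i p q] g4[of y i p q] pq y xA t by auto
    then have "{y,i,p,q} \<in> X" using x(1) pq(1) bB by (auto simp: f_def split: if_splits)
    moreover have "x - {k} = {i,p,q}" using pq by auto
    ultimately have "insert y (x - {k}) \<in> X" by simp
    then show ?thesis using column_eq[OF x(1) k(1) x(2) y(1)] by blast
  qed
  show e: "{y \<in> A. twin i y} = x \<union> {y \<in> A - x. insert y (x - {i}) \<in> X}"
    using 1 2 twin_in_X[OF x] xA by blast
  have "card (x \<union> {y \<in> A - x. insert y (x - {i}) \<in> X}) = 4 + card {y \<in> A - x. insert y (x - {i}) \<in> X}"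
    using xA finA by (subst card_Un_disjoint) auto
  then show "2 * card {y \<in> A. twin i y} = n + 1" unfolding e using column_card[OF x] by simp
qed

text \<open>Two twin classes of size \<open>(n + 1) / 2\<close> must overlap, so all vertices of \<open>X\<close> lie in the same class.\<close>

lemma X_in_twin_class:
  assumes x: "x \<in> X" "i \<in> x" and x': "x' \<in> X"
  shows "x' \<subseteq> {y \<in> A. twin i y}"
proof
  fix j assume j: "j \<in> x'"
  define W where "W p = {y \<in> A. twin p y}" for p
  have ijA: "i \<in> A" "j \<in> A" using x x' j X_sub by blast+
  have "W i \<inter> W j \<noteq> {}"
  proof
    assume "W i \<inter> W j = {}"
    then have "card (W i \<union> W j) = card (W i) + card (W j)"
      using finA by (intro card_Un_disjoint) (auto simp: W_def)
    moreover have "card (W i \<union> W j) \<le> n" unfolding n(1)[symmetric] using finA by (intro card_mono) (auto simp: W_def)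
    ultimately show False using twin_class(2)[OF x] twin_class(2)[OF x' j] by (simp add: W_def)
  qed
  then obtain y where "y \<in> A" "twin i y" "twin j y" by (auto simp: W_def)
  then have "twin i j" using twin_trans twin_sym ijA by blast
  then show "j \<in> {y \<in> A. twin i y}" using ijA by simp
qed

lemma no_split_weights: False
proof -
  obtain x where x: "x \<in> X" using X_ne by blast
  then have "card x \<ge> 1" using X_sub by auto
  then obtain i where i: "i \<in> x" using card_ge_1_obtain by blast
  define W where "W = {y \<in> A. twin i y}"
  have XW: "x' \<subseteq> W" if "x' \<in> X" for x' using X_in_twin_class[OF x i that] by (simp add: W_def)
  have WA: "W \<subseteq> A" "2 * card W = n + 1" "i \<in> W" "i \<in> A"
    using twin_class(2)[OF x i] XW[OF x] i by (auto simp: W_def)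
  have "card (A - W) + card W = n" using WA n finA by (simp add: card_Diff_subset finite_subset card_mono)
  then have "card (A - W) \<ge> 3" using WA n by simp
  then obtain p q r where pqr: "p \<in> A - W" "q \<in> A - W" "r \<in> A - W" "distinct [p,q,r]"
    using card_ge_3_obtain by blast
  define z where "z = {i,p,q,r}"
  have "i \<noteq> p" "i \<noteq> q" "i \<noteq> r" using pqr WA by auto
  then have "card z = 4" using pqr(4) by (simp add: z_def)
  then have z: "z \<subseteq> A" "card z = 4" "z \<notin> X" "finite z" using pqr WA XW by (auto simp: z_def)
  \<comment> \<open>Two exchanges remove at most two of \<open>p\<close>, \<open>q\<close>,
    \<open>r\<close>, so the result is never contained in \<open>W\<close>.\<close>
  have nz: "insert y (z - {t}) \<notin> X \<and> insert y' (insert y (z - {t}) - {t'}) \<notin> X" for t y t' y'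
  proof -
    have "\<exists>w \<in> {p,q,r} - {t,t'}. True" using pqr by auto
    then obtain w where "w \<in> z - {t,t'}" "w \<notin> W" using pqr by (auto simp: z_def)
    then show ?thesis using XW by blast
  qed
  \<comment> \<open>Otherwise \<open>z\<close> is a middle vertex and must have
    \<open>b \<ge> 1\<close> neighbours in \<open>X\<close>.\<close>
  have "z \<in> X'"
  proof (rule ccontr)
    assume "z \<notin> X'"
    then have "card {p \<in> z \<times> (A - z). insert (snd p) (z - {fst p}) \<in> X} = b" using mid_count z by blast
    moreover have "{p \<in> z \<times> (A - z). insert (snd p) (z - {fst p}) \<in> X} = {}" using nz by auto
    ultimately show False using bB by (metis card.empty not_one_le_zero)
  qed
  \<comment> \<open>Since \<open>2n - 14 < 4 (n - 4)\<close>, some neighbour \<open>z'\<close> of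
    \<open>z\<close> leaves \<open>X'\<close>. It is a middle vertex, and its neighbours are still
    within two exchanges of \<open>z\<close>.\<close>
  have "card (z \<times> (A - z)) = 4 * (n - 4)" using z n by (simp add: card_cartesian_product card_Diff_subset)
  then have "{p \<in> z \<times> (A - z). insert (snd p) (z - {fst p}) \<in> X'} \<noteq> z \<times> (A - z)"
    using X'_count[OF \<open>z \<in> X'\<close>] n by force
  then obtain e where "e \<in> z \<times> (A - z)" "insert (snd e) (z - {fst e}) \<notin> X'" by blast
  then obtain t y where ty: "t \<in> z" "y \<in> A - z" "insert y (z - {t}) \<notin> X'" by (metis mem_Times_iff)
  define z' where "z' = insert y (z - {t})"
  have z': "z' \<subseteq> A" "card z' = 4" "z' \<notin> X" "z' \<notin> X'"
    using ty z nz by (auto simp: z'_def card_Diff_singleton)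
  have "card {p \<in> z' \<times> (A - z'). insert (snd p) (z' - {fst p}) \<in> X} = b" using mid_count z' by blast
  moreover have "{p \<in> z' \<times> (A - z'). insert (snd p) (z' - {fst p}) \<in> X} = {}" using nz by (auto simp: z'_def)
  ultimately show False using bB by (metis card.empty not_one_le_zero)
qed

end

lemma (in johnson_split) no_split: False
proof -
  obtain g :: "'a \<Rightarrow> 'a \<Rightarrow> real" where g:
    "\<And>a b. g a b = g b a"
    "\<And>a b c. {a,b,c} \<subseteq> A \<Longrightarrow> distinct [a,b,c] \<Longrightarrow>
      (\<Sum>y\<in>A - {a,b,c}. f (insert y {a,b,c})) = (real n - 5) * (g a b + g a c + g b c)"
    "\<And>a b c d. {a,b,c,d} \<subseteq> A \<Longrightarrow> distinct [a,b,c,d] \<Longrightarrow>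
      f {a,b,c,d} = g a b + g a c + g a d + g b c + g b d + g c d"
    by (rule four_set_pair_weights[OF finA n(1)[symmetric] _ f_neighbour_sum]) (use n in auto)
  interpret johnson_split_weights A n B b X X' g
    by unfold_locales (fact g)+
  show False by (rule no_split_weights)
qed

section \<open>Layers of a code and Johnson graphs\<close>

text \<open>The nested infima collapse to the infimum of one set of walk lengths, and a nonempty set
  of extended naturals contains its infimum.\<close>

lemma code_dist_eq_iff:
  "code_dist E C v = enat i \<longleftrightarrow> (\<exists>c\<in>C. (v, c) \<in> E ^^ i) \<and> (\<forall>j<i. \<forall>c\<in>C. (v, c) \<notin> E ^^ j)"
proof -
  define R where "R = {enat k | k. \<exists>c\<in>C. (v, c) \<in> E ^^ k}"
  have le: "x \<le> code_dist E C v \<longleftrightarrow> x \<le> Inf R" for x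
    by (auto simp: code_dist_def graph_dist_def le_INF_iff le_Inf_iff R_def)
  have "code_dist E C v = Inf R"
    using le[of "code_dist E C v"] le[of "Inf R"] by (intro antisym) auto
  moreover have "Inf R = enat i \<longleftrightarrow> enat i \<in> R \<and> (\<forall>j<i. enat j \<notin> R)"
  proof
    assume i: "Inf R = enat i"
    \<comment> \<open>The infimum of the empty set is infinite.\<close>
    then have "R \<noteq> {}" by (auto simp: Inf_enat_def)
    then have "Inf R \<in> R" unfolding Inf_enat_def by (auto intro: LeastI)
    moreover have "enat j \<notin> R" if "j < i" for j
      using Inf_lower[of "enat j" R] that i by auto
    ultimately show "enat i \<in> R \<and> (\<forall>j<i. enat j \<notin> R)" using i by auto
  next
    assume i: "enat i \<in> R \<and> (\<forall>j<i. enat j \<notin> R)"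
    show "Inf R = enat i"
    proof (rule antisym)
      show "enat i \<le> Inf R"
      proof (rule Inf_greatest)
        fix r assume r: "r \<in> R"
        then obtain k where "r = enat k" by (auto simp: R_def)
        then show "enat i \<le> r" using i r by (metis enat_ord_simps(1) not_le_imp_less)
      qed
    qed (use i in \<open>auto intro: Inf_lower\<close>)
  qed
  ultimately show ?thesis by (auto simp: R_def)
qed

lemma layer_neighbour_le:
  assumes "v \<in> code_layer V E C i" "w \<in> code_layer V E C j" "(v, w) \<in> E"
  shows "i \<le> Suc j"
proof (rule ccontr)
  assume "\<not> i \<le> Suc j"
  moreover obtain c where c: "c \<in> C" "(w, c) \<in> E ^^ j"
    using assms(2) by (auto simp: code_layer_def code_dist_eq_iff)
  moreover have "(v, c) \<in> E ^^ Suc j" using assms(3) c(2) by (rule relpow_Suc_I2)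
  moreover have "\<forall>j<i. \<forall>c\<in>C. (v, c) \<notin> E ^^ j"
    using assms(1) unfolding code_layer_def code_dist_eq_iff by blast
  ultimately show False by (meson not_le_imp_less)
qed

text \<open>Take the second vertex of a shortest walk to \<open>C\<close>: a shorter walk from there
  would also shorten the one from \<open>v\<close>.\<close>

lemma layer_predecessor:
  assumes v: "v \<in> code_layer V E C (Suc i)" and E: "E \<subseteq> V \<times> V"
  shows "\<exists>w \<in> code_layer V E C i. (v, w) \<in> E"
proof -
  obtain c where c: "c \<in> C" "(v, c) \<in> E ^^ Suc i" and min: "\<And>j c. j < Suc i \<Longrightarrow> c \<in> C \<Longrightarrow> (v, c) \<notin> E ^^ j"
    using v unfolding code_layer_def code_dist_eq_iff by auto
  obtain w where w: "(v, w) \<in> E" "(w, c) \<in> E ^^ i" using c(2) by (rule relpow_Suc_E2)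
  have "(w, d) \<notin> E ^^ j" if "j < i" "d \<in> C" for j d
    using min[of "Suc j" d] relpow_Suc_I2[OF w(1), of d j] that by auto
  then have "w \<in> code_layer V E C i" using w c E by (auto simp: code_layer_def code_dist_eq_iff)
  then show ?thesis using w by blast
qed

lemma reachable_in_some_layer:
  assumes "v \<in> V" "c \<in> C" "(v, c) \<in> E ^^ k"
  shows "\<exists>i. v \<in> code_layer V E C i"
proof -
  define i where "i = (LEAST k. \<exists>c\<in>C. (v, c) \<in> E ^^ k)"
  have "\<exists>c\<in>C. (v, c) \<in> E ^^ i" unfolding i_def using assms by (intro LeastI) auto
  moreover have "\<forall>j<i. \<forall>c\<in>C. (v, c) \<notin> E ^^ j" unfolding i_def using not_less_Least by blast
  ultimately show ?thesis using assms by (auto simp: code_layer_def code_dist_eq_iff)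
qed

section \<open>Adjacency in Johnson graphs as exchange of one point\<close>

lemma johnson_vertexD:
  assumes "v \<in> johnson_vertices n 4" shows "v \<subseteq> {1..n}" "card v = 4" "finite v"
  using assms finite_subset by (auto simp: johnson_vertices_def)

lemma johnson_exchange:
  assumes v: "v \<in> johnson_vertices n 4" and "i \<in> v" "y \<in> {1..n} - v"
  shows "(v, insert y (v - {i})) \<in> johnson_edges n 4" "insert y (v - {i}) \<in> johnson_vertices n 4"
proof -
  have "v \<inter> insert y (v - {i}) = v - {i}" using assms by auto
  moreover have "card (v - {i}) = 3" using johnson_vertexD[OF v] assms by simp
  moreover show "insert y (v - {i}) \<in> johnson_vertices n 4"
    using johnson_vertexD[OF v] assms by (auto simp: johnson_vertices_def card_insert_if)
  ultimately show "(v, insert y (v - {i})) \<in> johnson_edges n 4"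
    using v by (simp add: johnson_edges_def)
qed

lemma johnson_edge_exchange:
  assumes "(v, w) \<in> johnson_edges n 4"
  shows "\<exists>i y. i \<in> v \<and> y \<in> {1..n} - v \<and> w = insert y (v - {i})"
proof -
  have vw: "v \<in> johnson_vertices n 4" "w \<in> johnson_vertices n 4" "card (v \<inter> w) = 3"
    using assms by (auto simp: johnson_edges_def)
  note v = johnson_vertexD[OF vw(1)] and w = johnson_vertexD[OF vw(2)]
  have "card (v - w) = 1" "card (w - v) = 1"
    using v w vw(3) by (simp_all add: card_Diff_subset_Int Int_commute)
  then obtain i y where iy: "v - w = {i}" "w - v = {y}" by (metis card_1_singletonE)
  have "w = insert y (v - {i})" using iy by blast
  moreover have "i \<in> v" "y \<in> {1..n} - v" using iy w by blast+
  ultimately show ?thesis by blast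
qed

lemma johnson_edges_sym: "(v, w) \<in> johnson_edges n k \<Longrightarrow> (w, v) \<in> johnson_edges n k"
  by (simp add: johnson_edges_def Int_commute)

text \<open>An exchange can be recovered from its result, as the removed and the added point are the
  two set differences. This links neighbour counts to the pair counts of
  \<open>johnson_split\<close>.\<close>

lemma johnson_nbrs_in:
  assumes v: "v \<in> johnson_vertices n 4"
  shows "nbrs_in (johnson_edges n 4) v S =
    card {p \<in> v \<times> ({1..n} - v). insert (snd p) (v - {fst p}) \<in> S}"
proof -
  define h where "h p = insert (snd p) (v - {fst p})" for p
  have "inj_on h (v \<times> ({1..n} - v))"
  proof (rule inj_onI)
    fix p q assume p: "p \<in> v \<times> ({1..n} - v)" and q: "q \<in> v \<times> ({1..n} - v)" and e: "h p = h q"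
    have "v - h p = {fst p}" "h p - v = {snd p}" using p by (auto simp: h_def)
    moreover have "v - h q = {fst q}" "h q - v = {snd q}" using q by (auto simp: h_def)
    ultimately show "p = q" using e by (simp add: prod_eq_iff)
  qed
  then have inj: "inj_on h {p \<in> v \<times> ({1..n} - v). h p \<in> S}" by (rule inj_on_subset) auto
  have "{u \<in> S. (v, u) \<in> johnson_edges n 4} = h ` {p \<in> v \<times> ({1..n} - v). h p \<in> S}"
  proof (intro equalityI subsetI)
    fix u assume "u \<in> {u \<in> S. (v, u) \<in> johnson_edges n 4}"
    then have u: "u \<in> S" "(v, u) \<in> johnson_edges n 4" by auto
    obtain i y where "i \<in> v" "y \<in> {1..n} - v" "u = insert y (v - {i})"
      using johnson_edge_exchange[OF u(2)] by blast
    then show "u \<in> h ` {p \<in> v \<times> ({1..n} - v). h p \<in> S}"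
      using u(1) by (intro image_eqI[of _ _ "(i, y)"]) (auto simp: h_def)
  qed (use johnson_exchange[OF v] in \<open>auto simp: h_def\<close>)
  then show ?thesis unfolding nbrs_in_def using card_image[OF inj] by (simp add: h_def)
qed

lemma johnson_connected:
  assumes c: "c \<in> johnson_vertices n 4" and "v \<in> johnson_vertices n 4"
  shows "\<exists>k. (v, c) \<in> johnson_edges n 4 ^^ k"
  using assms(2)
proof (induction "card (v - c)" arbitrary: v rule: less_induct)
  case less
  note v = johnson_vertexD[OF less.prems] and c' = johnson_vertexD[OF c]
  show ?case
  proof (cases "v \<subseteq> c")
    case True
    then have "v = c" using v c' by (simp add: card_subset_eq)
    then have "(v, c) \<in> johnson_edges n 4 ^^ 0" by simp
    then show ?thesis by blast
  next
    case False
    then obtain i where i: "i \<in> v - c" by blast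
    have "\<not> c \<subseteq> v" using v c' False by (metis card_subset_eq order_refl)
    then obtain y where y: "y \<in> c - v" by blast
    define w where "w = insert y (v - {i})"
    have "w - c = v - c - {i}" using y i by (auto simp: w_def)
    then have "card (w - c) < card (v - c)" using i v by (intro psubset_card_mono) auto
    moreover have vw: "(v, w) \<in> johnson_edges n 4" "w \<in> johnson_vertices n 4"
      unfolding w_def using johnson_exchange[OF less.prems, of i y] i y c' by auto
    ultimately obtain k where "(w, c) \<in> johnson_edges n 4 ^^ k" using less.hyps by blast
    then show ?thesis using relpow_Suc_I2[OF vw(1)] by blast
  qed
qed

section \<open>Edge counts, and the characteristic equation of a tridiagonal matrix\<close>

lemma nbrs_in_Un:
  assumes "finite S" "finite T" "S \<inter> T = {}"
  shows "nbrs_in E v (S \<union> T) = nbrs_in E v S + nbrs_in E v T"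
proof -
  have "{u \<in> S \<union> T. (v, u) \<in> E} = {u \<in> S. (v, u) \<in> E} \<union> {u \<in> T. (v, u) \<in> E}" by auto
  then show ?thesis unfolding nbrs_in_def using assms by (simp add: card_Un_disjoint disjoint_iff)
qed

lemma double_count:
  assumes "finite S" "finite T" "\<And>v w. (v, w) \<in> E \<Longrightarrow> (w, v) \<in> E"
  shows "(\<Sum>v\<in>S. nbrs_in E v T) = (\<Sum>w\<in>T. nbrs_in E w S)"
proof -
  have 1: "nbrs_in E v W = (\<Sum>w\<in>W. of_bool ((v, w) \<in> E))" if "finite W" for v W
    using that by (simp add: nbrs_in_def Int_def)
  have "(v, w) \<in> E \<longleftrightarrow> (w, v) \<in> E" for v w using assms(3) by blast
  then show ?thesis using assms(1,2) by (simp only: 1) (subst sum.swap, simp)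
qed

lemma tridiagonal_eigenvalue:
  fixes \<theta> :: real
  assumes "eigenvalue (mat_of_rows_list 3 [[a0,b0,0],[c1,a1,b1],[0,c2,a2]]) \<theta>"
  shows "(\<theta> - a0) * ((\<theta> - a1) * (\<theta> - a2) - b1 * c2) - b0 * c1 * (\<theta> - a2) = 0" (is "?p = 0")
proof -
  define M where "M = mat_of_rows_list 3 [[a0,b0,0],[c1,a1,b1],[0,c2,a2]]"
  have M: "M = mat 3 3 (\<lambda>(i,j). [[a0,b0,0],[c1,a1,b1],[0,c2,a2]] ! i ! j)"
    by (simp add: M_def mat_of_rows_list_def numeral_3_eq_3)
  obtain v where v: "v \<in> carrier_vec 3" "v \<noteq> 0\<^sub>v 3" "M *\<^sub>v v = \<theta> \<cdot>\<^sub>v v"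
    using assms unfolding eigenvalue_def eigenvector_def M_def[symmetric] by (auto simp: M)
  define x y z where "x = v $ 0" and "y = v $ 1" and "z = v $ 2"
  have dv: "dim_vec v = 3" using v by auto
  have eq: "(\<Sum>j = 0..<3. M $$ (i, j) * v $ j) = \<theta> * v $ i" if "i < 3" for i
  proof -
    have "(M *\<^sub>v v) $ i = (\<theta> \<cdot>\<^sub>v v) $ i" using v by simp
    then show ?thesis using that dv by (simp add: M scalar_prod_def)
  qed
  have e: "a0 * x + b0 * y = \<theta> * x" "c1 * x + a1 * y + b1 * z = \<theta> * y" "c2 * y + a2 * z = \<theta> * z"
    using eq[of 0] eq[of 1] eq[of 2] by (simp_all add: M x_def y_def z_def numeral_3_eq_3 numeral_2_eq_2)
  define r1 r2 r3 where "r1 = \<theta> * x - a0 * x - b0 * y" and "r2 = \<theta> * y - c1 * x - a1 * y - b1 * z"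
    and "r3 = \<theta> * z - c2 * y - a2 * z"
  \<comment> \<open>The coefficients are the rows of the adjugate of \<open>\<theta> I - M\<close>,
    and \<open>?p\<close> is its determinant.\<close>
  have "?p * x = ((\<theta> - a1) * (\<theta> - a2) - b1 * c2) * r1 + b0 * (\<theta> - a2) * r2 + b0 * b1 * r3"
    "?p * y = c1 * (\<theta> - a2) * r1 + (\<theta> - a0) * (\<theta> - a2) * r2 + b1 * (\<theta> - a0) * r3"
    "?p * z = c1 * c2 * r1 + c2 * (\<theta> - a0) * r2 + ((\<theta> - a0) * (\<theta> - a1) - b0 * c1) * r3"
    by (simp_all add: r1_def r2_def r3_def algebra_simps)
  moreover have "r1 = 0" "r2 = 0" "r3 = 0" using e by (simp_all add: r1_def r2_def r3_def)
  ultimately have "?p * x = 0" "?p * y = 0" "?p * z = 0" by simp_all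
  moreover have "\<not> (x = 0 \<and> y = 0 \<and> z = 0)"
  proof
    assume "x = 0 \<and> y = 0 \<and> z = 0"
    then have "v = 0\<^sub>v 3" using dv
      by (intro eq_vecI) (auto simp: x_def y_def z_def numeral_3_eq_3 numeral_2_eq_2 less_Suc_eq)
    then show False using v by simp
  qed
  ultimately show ?thesis by auto
qed

lemma johnson_degree:
  assumes "v \<in> johnson_vertices n 4"
  shows "nbrs_in (johnson_edges n 4) v (johnson_vertices n 4) = 4 * (n - 4)"
proof -
  note v = johnson_vertexD[OF assms]
  have all: "{p \<in> v \<times> ({1..n} - v). insert (snd p) (v - {fst p}) \<in> johnson_vertices n 4} = v \<times> ({1..n} - v)"
    using johnson_exchange(2)[OF assms] by auto
  have "card ({1..n} - v) = n - 4" using v by (simp add: card_Diff_subset)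
  then show ?thesis unfolding johnson_nbrs_in[OF assms] all card_cartesian_product v(2) by simp
qed

section \<open>Excluding balanced splittings, and the parameters of codes of covering radius
  two\<close>

lemma finite_johnson_vertices: "finite (johnson_vertices n k)"
  by (rule finite_subset[of _ "Pow {1..n}"]) (auto simp: johnson_vertices_def)

text \<open>Restates \<open>johnson_split\<close> through neighbour counts; the zero count between
  \<open>X\<close> and \<open>X'\<close> supplies the separation.\<close>

lemma no_balanced_split:
  assumes n: "n \<ge> 9" and V: "johnson_vertices n 4 = X \<union> K \<union> X'"
    and disj: "X \<inter> X' = {}" and ne: "X \<noteq> {}"
    and X: "\<And>v. v \<in> X \<Longrightarrow> nbrs_in (johnson_edges n 4) v X + 14 = 2 * n \<and> nbrs_in (johnson_edges n 4) v X' = 0"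
    and X': "\<And>v. v \<in> X' \<Longrightarrow> nbrs_in (johnson_edges n 4) v X' + 14 = 2 * n"
    and K: "\<And>v. v \<in> K \<Longrightarrow> nbrs_in (johnson_edges n 4) v X = b \<and> nbrs_in (johnson_edges n 4) v X' = B"
    and b: "1 \<le> b" "b \<le> B" "b + B + 4 = n"
  shows False
proof -
  note nb = johnson_nbrs_in[symmetric]
  interpret johnson_split "{1..n}" n B b X X'
  proof
    show "x \<subseteq> {1..n} \<and> card x = 4" if "x \<in> X \<union> X'" for x
      using that V johnson_vertexD[of x n] by auto
    show "insert y (x - {i}) \<notin> X'" if x: "x \<in> X" "i \<in> x" "y \<in> {1..n} - x" for x i y
    proof
      assume "insert y (x - {i}) \<in> X'"
      then have iy: "(i, y) \<in> {p \<in> x \<times> ({1..n} - x). insert (snd p) (x - {fst p}) \<in> X'}" (is "_ \<in> ?S")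
        using x by simp
      have xV: "x \<in> johnson_vertices n 4" using x V by blast
      have "finite ?S"
        by (rule finite_subset[of _ "x \<times> ({1..n} - x)"]) (use johnson_vertexD(3)[OF xV] in auto)
      then have "card ?S > 0" using iy card_gt_0_iff by blast
      moreover have "card ?S = 0" using X[OF x(1)] by (simp only: nb[OF xV])
      ultimately show False by simp
    qed
    show "card {p \<in> x \<times> ({1..n} - x). insert (snd p) (x - {fst p}) \<in> X} + 14 = 2 * n" if "x \<in> X" for x
    proof -
      have xV: "x \<in> johnson_vertices n 4" using that V by blast
      show ?thesis using X[OF that] by (simp only: nb[OF xV])
    qed
    show "card {p \<in> x \<times> ({1..n} - x). insert (snd p) (x - {fst p}) \<in> X'} + 14 = 2 * n" if "x \<in> X'" for x
    proof -
      have xV: "x \<in> johnson_vertices n 4" using that V by blast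
      show ?thesis using X'[OF that] by (simp only: nb[OF xV])
    qed
    fix x :: "nat set" assume x: "x \<subseteq> {1..n}" "card x = 4" "x \<notin> X" "x \<notin> X'"
    then have xV: "x \<in> johnson_vertices n 4" and "x \<in> K" using V by (auto simp: johnson_vertices_def)
    then show "card {p \<in> x \<times> ({1..n} - x). insert (snd p) (x - {fst p}) \<in> X} = b"
      "card {p \<in> x \<times> ({1..n} - x). insert (snd p) (x - {fst p}) \<in> X'} = B"
      using K[OF \<open>x \<in> K\<close>] by (simp_all only: nb[OF xV])
  qed (use n disj ne b in auto)
  show False by (rule no_split)
qed

text \<open>Counting the edges between \<open>D\<close> and \<open>K\<close> gives
  \<open>14 |D| = 4 |K|\<close>; with \<open>|D| + |K| = 70\<close> this means
  \<open>18 |D| = 280\<close>, which has no integer solution.\<close>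

lemma no_split_8:
  assumes V: "johnson_vertices 8 4 = D \<union> K" and disj: "D \<inter> K = {}"
    and D: "\<And>v. v \<in> D \<Longrightarrow> nbrs_in (johnson_edges 8 4) v K = 14"
    and K: "\<And>v. v \<in> K \<Longrightarrow> nbrs_in (johnson_edges 8 4) v D = 4"
  shows False
proof -
  have fin: "finite D" "finite K" using finite_johnson_vertices[of 8 4] unfolding V by simp_all
  have "card (johnson_vertices 8 4) = card {1..8::nat} choose 4"
    unfolding johnson_vertices_def by (rule n_subsets) (rule finite_atLeastAtMost)
  also have "\<dots> = 8 choose 4" by (simp only: card_atLeastAtMost diff_Suc_1)
  also have "\<dots> = 70" by (simp add: eval_nat_numeral)
  finally have "card (D \<union> K) = 70" unfolding V .
  then have "card D + card K = 70" using card_Un_disjoint[OF fin disj] by simp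
  moreover have "14 * card D = 4 * card K"
    using double_count[OF fin johnson_edges_sym, of 8 4] D K by simp
  ultimately have "card D < 16" "card D > 15" by linarith+
  then show False by simp
qed

text \<open>Connectedness puts every vertex into some layer, so the covering radius leaves exactly
  three layers; the row sums are the degree \<open>4 (n - 4)\<close>.\<close>

lemma johnson_radius2_parameters:
  fixes n :: nat and C :: "nat set set"
  defines "V \<equiv> johnson_vertices n 4" and "E \<equiv> johnson_edges n 4"
  defines "L \<equiv> code_layer V E C"
  assumes cr: "completely_regular V E C" and \<rho>: "covering_radius V E C = 2"
  obtains a0 b0 c1 a1 b1 c2 a2 :: nat where
    "intersection_matrix V E C =
       mat_of_rows_list 3 [[real a0, real b0, 0], [real c1, real a1, real b1], [0, real c2, real a2]]"
    "V = L 0 \<union> L 1 \<union> L 2"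
    "L 0 \<inter> L 1 = {}" "L 0 \<inter> L 2 = {}" "L 1 \<inter> L 2 = {}"
    "L 0 \<noteq> {}" "L 2 \<noteq> {}"
    "\<forall>v\<in>L 0. nbrs_in E v (L 0) = a0 \<and> nbrs_in E v (L 1) = b0 \<and> nbrs_in E v (L 2) = 0"
    "\<forall>v\<in>L 1. nbrs_in E v (L 0) = c1 \<and> nbrs_in E v (L 1) = a1 \<and> nbrs_in E v (L 2) = b1"
    "\<forall>v\<in>L 2. nbrs_in E v (L 0) = 0 \<and> nbrs_in E v (L 1) = c2 \<and> nbrs_in E v (L 2) = a2"
    "a0 + b0 = 4 * (n - 4)" "c1 + a1 + b1 = 4 * (n - 4)" "c2 + a2 = 4 * (n - 4)"
    "b0 > 0" "b1 > 0" "c1 > 0" "c2 > 0"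
proof -
  have finV: "finite V" unfolding V_def by (rule finite_johnson_vertices)
  have EV: "E \<subseteq> V \<times> V" by (auto simp: E_def V_def johnson_edges_def)
  have sym: "(w, v) \<in> E" if "(v, w) \<in> E" for v w using that unfolding E_def by (rule johnson_edges_sym)
  have LV: "L i \<subseteq> V" for i by (auto simp: L_def code_layer_def)
  have disj: "i = j" if "v \<in> L i" "v \<in> L j" for v i j using that by (auto simp: L_def code_layer_def)
  have nbr: "i \<le> Suc j" if "v \<in> L i" "w \<in> L j" "(v, w) \<in> E" for v w i j
    using that unfolding L_def by (rule layer_neighbour_le)
  have pred: "\<exists>w \<in> L i. (v, w) \<in> E" if "v \<in> L (Suc i)" for v i
    using that EV unfolding L_def by (rule layer_predecessor)
  have C: "C \<subseteq> V" "C \<noteq> {}" using cr by (auto simp: completely_regular_def)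
  have some: "\<exists>i. v \<in> L i" if v: "v \<in> V" for v
  proof -
    obtain c where "c \<in> C" "c \<in> V" using C by blast
    then obtain k where "(v, c) \<in> E ^^ k" using johnson_connected v unfolding V_def E_def by blast
    then show ?thesis unfolding L_def using v \<open>c \<in> C\<close> by (intro reachable_in_some_layer)
  qed
  define I where "I = {i. L i \<noteq> {}}"
  \<comment> \<open>Mapping a vertex to its layer index bounds the set of nonempty layers, so that
    \<open>Max\<close> is attained.\<close>
  have "I \<subseteq> (\<lambda>v. THE i. v \<in> L i) ` V"
  proof
    fix i assume "i \<in> I"
    then obtain v where v: "v \<in> L i" by (auto simp: I_def)
    then have "(THE i. v \<in> L i) = i" using disj by (intro the_equality) auto
    then show "i \<in> (\<lambda>v. THE i. v \<in> L i) ` V" using v LV by blast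
  qed
  then have finI: "finite I" using finV finite_surj by blast
  have I_ne: "I \<noteq> {}" using C some by (auto simp: I_def)
  have Max: "Max I = 2" using \<rho> by (simp add: covering_radius_def I_def L_def)
  have L2: "L 2 \<noteq> {}" using Max_in[OF finI I_ne] Max by (simp add: I_def)
  have VL: "V = L 0 \<union> L 1 \<union> L 2"
  proof
    show "V \<subseteq> L 0 \<union> L 1 \<union> L 2"
    proof
      fix v assume "v \<in> V"
      then obtain i where i: "v \<in> L i" using some by blast
      then have "i \<le> 2" using Max_ge[OF finI] Max by (auto simp: I_def)
      then have "i = 0 \<or> i = 1 \<or> i = 2" by auto
      then show "v \<in> L 0 \<union> L 1 \<union> L 2" using i by auto
    qed
  qed (use LV in auto)
  have dj: "L 0 \<inter> L 1 = {}" "L 0 \<inter> L 2 = {}" "L 1 \<inter> L 2 = {}"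
    using disj[of _ 0 1] disj[of _ 0 2] disj[of _ 1 2] by auto
  \<comment> \<open>The walk \<open>p\<close>, \<open>q\<close>, \<open>r\<close> down the layers
    shows that all three are nonempty and that its edges make all four off-diagonal parameters
    positive.\<close>
  obtain p where p: "p \<in> L 2" using L2 by blast
  obtain q where q: "q \<in> L 1" "(p, q) \<in> E" using pred[of p 1] p by (auto simp: numeral_2_eq_2)
  obtain r where r: "r \<in> L 0" "(q, r) \<in> E" using pred[of q 0] q by auto
  obtain \<alpha> \<beta> \<gamma> :: "nat \<Rightarrow> nat" where reg: "\<And>i v. v \<in> L i \<Longrightarrow>
      nbrs_in E v (L i) = \<alpha> i \<and> nbrs_in E v (L (i + 1)) = \<beta> i \<and>
      nbrs_in E v (prev_layer V E C i) = \<gamma> i"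
    using cr unfolding completely_regular_def L_def by blast
  \<comment> \<open>A vertex in the layer makes each of the three \<open>THE\<close> values
    unique.\<close>
  have code: "code_alpha V E C i = \<alpha> i \<and> code_beta V E C i = \<beta> i \<and> code_gamma V E C i = \<gamma> i"
    if v: "v \<in> L i" for v i
    unfolding code_alpha_def code_beta_def code_gamma_def L_def[symmetric]
    using reg v by (intro conjI the_equality) auto
  have prev: "prev_layer V E C 1 = L 0" "prev_layer V E C 2 = L 1" by (simp_all add: prev_layer_def L_def)
  have zero: "nbrs_in E v (L j) = 0" if "v \<in> L i" "Suc i < j \<or> Suc j < i" for v i j
  proof -
    have "{u \<in> L j. (v, u) \<in> E} = {}" using nbr[of v i _ j] nbr[of _ j v i] that sym by fastforce
    then show ?thesis by (simp only: nbrs_in_def card.empty)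
  qed
  have cnt: "v \<in> L 0 \<Longrightarrow> nbrs_in E v (L 0) = \<alpha> 0 \<and> nbrs_in E v (L 1) = \<beta> 0 \<and> nbrs_in E v (L 2) = 0"
    "v \<in> L 1 \<Longrightarrow> nbrs_in E v (L 0) = \<gamma> 1 \<and> nbrs_in E v (L 1) = \<alpha> 1 \<and> nbrs_in E v (L 2) = \<beta> 1"
    "v \<in> L 2 \<Longrightarrow> nbrs_in E v (L 0) = 0 \<and> nbrs_in E v (L 1) = \<gamma> 2 \<and> nbrs_in E v (L 2) = \<alpha> 2" for v
    using reg[of v 0] reg[of v 1] reg[of v 2] zero[of v 0 2] zero[of v 2 0] prev
    by (simp_all add: numeral_2_eq_2)
  have fin: "finite (L i)" for i using LV finV finite_subset by blast
  have total: "nbrs_in E v (L 0) + nbrs_in E v (L 1) + nbrs_in E v (L 2) = 4 * (n - 4)" if "v \<in> V" for v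
  proof -
    have "nbrs_in E v V = 4 * (n - 4)" using johnson_degree that unfolding V_def E_def by blast
    moreover have "nbrs_in E v V = nbrs_in E v (L 0) + nbrs_in E v (L 1) + nbrs_in E v (L 2)"
      unfolding VL using fin dj by (simp add: nbrs_in_Un Int_Un_distrib2)
    ultimately show ?thesis by simp
  qed
  have pos: "nbrs_in E v (L i) > 0" if "w \<in> L i" "(v, w) \<in> E" for v w i
    using that fin by (auto simp: nbrs_in_def card_gt_0_iff)
  have "intersection_matrix V E C = mat_of_rows_list 3
      [[real (\<alpha> 0), real (\<beta> 0), 0], [real (\<gamma> 1), real (\<alpha> 1), real (\<beta> 1)], [0, real (\<gamma> 2), real (\<alpha> 2)]]"
    unfolding intersection_matrix_def \<rho> Let_def mat_of_rows_list_def
    using code[OF r(1)] code[OF q(1)] code[OF p]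
    by (intro eq_matI) (auto simp: numeral_2_eq_2 numeral_3_eq_3 less_Suc_eq)
  then show thesis
  proof (rule that)
    show "\<alpha> 0 + \<beta> 0 = 4 * (n - 4)" using total[of r] cnt(1)[OF r(1)] r(1) LV by auto
    show "\<gamma> 1 + \<alpha> 1 + \<beta> 1 = 4 * (n - 4)" using total[of q] cnt(2)[OF q(1)] q(1) LV by auto
    show "\<gamma> 2 + \<alpha> 2 = 4 * (n - 4)" using total[of p] cnt(3)[OF p] p LV by auto
    show "\<beta> 0 > 0" using pos[OF q(1) sym[OF r(2)]] cnt(1)[OF r(1)] by simp
    show "\<beta> 1 > 0" using pos[OF p sym[OF q(2)]] cnt(2)[OF q(1)] by simp
    show "\<gamma> 1 > 0" using pos[OF r(1) r(2)] cnt(2)[OF q(1)] by simp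
    show "\<gamma> 2 > 0" using pos[OF q(1) q(2)] cnt(3)[OF p] by simp
  qed (use VL dj cnt r L2 in auto)
qed

section \<open>Solving for the matrix entries from the spectrum\<close>

theorem theorem7:
  fixes n :: nat and C :: "nat set set"
  assumes "n \<ge> 8"
    and "completely_regular (johnson_vertices n 4) (johnson_edges n 4) C"
    and "covering_radius (johnson_vertices n 4) (johnson_edges n 4) C = 2"
    and "code_spec (johnson_vertices n 4) (johnson_edges n 4) C =
           {johnson_eigenvalue n 4 0, johnson_eigenvalue n 4 2, johnson_eigenvalue n 4 3}"
  shows "\<exists>\<beta>\<^sub>0 \<gamma>\<^sub>2 :: int. \<beta>\<^sub>0 > 0 \<and> \<gamma>\<^sub>2 > 0 \<and> \<beta>\<^sub>0 \<noteq> \<gamma>\<^sub>2 \<and>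
    (let N = real n; b = real_of_int \<beta>\<^sub>0; c = real_of_int \<gamma>\<^sub>2 in
      intersection_matrix (johnson_vertices n 4) (johnson_edges n 4) C =
      mat_of_rows_list 3
        [[4 * N - 16 - b, b, 0],
         [- ((b - 2 * N + 2) * (b - 3 * N + 6) / (b - c)),
          b + c - N - 8,
          (c - 2 * N + 2) * (c - 3 * N + 6) / (b - c)],
         [0, c, 4 * N - 16 - c]])"
proof -
  define V where "V = johnson_vertices n 4"
  define E where "E = johnson_edges n 4"
  define L where "L = code_layer V E C"
  define N where "N = real n"
  obtain a0 b0 c1 a1 b1 c2 a2 :: nat where
    M: "intersection_matrix V E C =
       mat_of_rows_list 3 [[real a0, real b0, 0], [real c1, real a1, real b1], [0, real c2, real a2]]"
    and VL: "V = L 0 \<union> L 1 \<union> L 2"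
    and dj: "L 0 \<inter> L 1 = {}" "L 0 \<inter> L 2 = {}" "L 1 \<inter> L 2 = {}"
    and ne: "L 0 \<noteq> {}" "L 2 \<noteq> {}"
    and cnt0: "\<forall>v\<in>L 0. nbrs_in E v (L 0) = a0 \<and> nbrs_in E v (L 1) = b0 \<and> nbrs_in E v (L 2) = 0"
    and cnt1: "\<forall>v\<in>L 1. nbrs_in E v (L 0) = c1 \<and> nbrs_in E v (L 1) = a1 \<and> nbrs_in E v (L 2) = b1"
    and cnt2: "\<forall>v\<in>L 2. nbrs_in E v (L 0) = 0 \<and> nbrs_in E v (L 1) = c2 \<and> nbrs_in E v (L 2) = a2"
    and sums: "a0 + b0 = 4 * (n - 4)" "c1 + a1 + b1 = 4 * (n - 4)" "c2 + a2 = 4 * (n - 4)"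
    and pos: "b0 > 0" "b1 > 0" "c1 > 0" "c2 > 0"
    by (rule johnson_radius2_parameters[OF assms(2,3), folded V_def E_def, folded L_def]) (rule that)
  have N8: "N \<ge> 8" using assms(1) by (simp add: N_def)
  have rsums: "real a0 = 4 * N - 16 - real b0" "real a1 = 4 * N - 16 - real c1 - real b1"
    "real a2 = 4 * N - 16 - real c2"
  proof -
    have k: "real (4 * (n - 4)) = 4 * N - 16" using assms(1) by (simp add: N_def)
    show "real a0 = 4 * N - 16 - real b0" using k unfolding sums(1)[symmetric] by simp
    show "real a1 = 4 * N - 16 - real c1 - real b1" using k unfolding sums(2)[symmetric] by simp
    show "real a2 = 4 * N - 16 - real c2" using k unfolding sums(3)[symmetric] by simp
  qed
  \<comment> \<open>For \<open>M\<close> the intersection matrix, \<open>(4n - 16) I - M\<close> has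
    row sums 0; \<open>\<sigma>\<close> is its trace and \<open>e\<close> its second symmetric
    function, so its nonzero eigenvalues are roots of one quadratic.\<close>
  define \<sigma> where "\<sigma> = real b0 + real b1 + real c1 + real c2"
  define e where "e = real b0 * real b1 + real b0 * real c2 + real c1 * real c2"
  have root: "\<mu> * \<mu> - \<sigma> * \<mu> + e = 0"
    if "4 * N - 16 - \<mu> \<in> code_spec V E C" "\<mu> \<noteq> 0" for \<mu>
  proof -
    define \<theta> where "\<theta> = 4 * N - 16 - \<mu>"
    have "(\<theta> - real a0) * ((\<theta> - real a1) * (\<theta> - real a2) - real b1 * real c2) - real b0 * real c1 * (\<theta> - real a2) = 0"
      using that(1) unfolding code_spec_def M spectrum_def \<theta>_def[symmetric] by (intro tridiagonal_eigenvalue) simp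
    moreover have "\<theta> - real a0 = real b0 - \<mu>" "\<theta> - real a1 = real b1 + real c1 - \<mu>" "\<theta> - real a2 = real c2 - \<mu>"
      using rsums by (simp_all add: \<theta>_def)
    ultimately have "(real b0 - \<mu>) * ((real b1 + real c1 - \<mu>) * (real c2 - \<mu>) - real b1 * real c2) - real b0 * real c1 * (real c2 - \<mu>) = 0" by simp
    then have "\<mu> * (\<mu> * \<mu> - \<sigma> * \<mu> + e) = 0" by (simp add: \<sigma>_def e_def algebra_simps)
    then show ?thesis using that(2) by simp
  qed
  \<comment> \<open>\<open>2n - 2\<close> and \<open>3n - 6\<close> are the differences between the
    degree and the eigenvalues with index 2 and 3.\<close>
  have spec: "4 * N - 16 - (2 * N - 2) \<in> code_spec V E C" "4 * N - 16 - (3 * N - 6) \<in> code_spec V E C"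
    using assms(4) unfolding V_def E_def by (simp_all add: johnson_eigenvalue_def N_def algebra_simps)
  have r1: "(2 * N - 2) * (2 * N - 2) - \<sigma> * (2 * N - 2) + e = 0"
    and r2: "(3 * N - 6) * (3 * N - 6) - \<sigma> * (3 * N - 6) + e = 0"
    using root[OF spec(1)] root[OF spec(2)] N8 by auto
  \<comment> \<open>Subtracting the two quadratic equations leaves the factor
    \<open>(3N - 6) - (2N - 2) = N - 4\<close>.\<close>
  then have "(N - 4) * (\<sigma> - (5 * N - 8)) = 0" by (simp add: algebra_simps)
  then have \<sigma>: "\<sigma> = 5 * N - 8" using N8 by simp
  have e: "e = (2 * N - 2) * (3 * N - 6)" using r1 unfolding \<sigma> by (simp add: algebra_simps)
  \<comment> \<open>Eliminating \<open>c1\<close>, respectively \<open>b1\<close>, through the trace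
    makes \<open>e\<close> linear in the remaining one.\<close>
  have bc1: "real b1 * (real b0 - real c2) = (real c2 - 2 * N + 2) * (real c2 - 3 * N + 6)"
    and bc2: "real c1 * (real b0 - real c2) = - ((real b0 - 2 * N + 2) * (real b0 - 3 * N + 6))"
  proof -
    have s: "real c1 = 5 * N - 8 - real b0 - real b1 - real c2" using \<sigma> by (simp add: \<sigma>_def)
    show "real b1 * (real b0 - real c2) = (real c2 - 2 * N + 2) * (real c2 - 3 * N + 6)"
      using e unfolding e_def s by (simp add: algebra_simps)
    have s: "real b1 = 5 * N - 8 - real b0 - real c1 - real c2" using \<sigma> by (simp add: \<sigma>_def)
    show "real c1 * (real b0 - real c2) = - ((real b0 - 2 * N + 2) * (real b0 - 3 * N + 6))"
      using e unfolding e_def s by (simp add: algebra_simps)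
  qed
  have "b0 \<noteq> c2"
  proof
    assume eq: "b0 = c2"
    then have "(real b0 - 2 * N + 2) * (real b0 - 3 * N + 6) = 0" using bc2 by simp
    then have "real b0 = 2 * N - 2 \<or> real b0 = 3 * N - 6" by auto
    \<comment> \<open>Twice \<open>3N - 6\<close> would exceed the trace
      \<open>5N - 8\<close>.\<close>
    moreover have "real b0 \<noteq> 3 * N - 6" using \<sigma> eq N8 by (auto simp: \<sigma>_def)
    ultimately have rb: "real b0 = 2 * N - 2" by blast
    then have "real (b0 + 2) = real (2 * n)" "real (b1 + c1 + 4) = real n"
      using \<sigma> eq by (simp_all add: \<sigma>_def N_def)
    then have b: "b0 + 2 = 2 * n" "b1 + c1 + 4 = n" unfolding of_nat_eq_iff by auto
    then have a: "a0 + 14 = 2 * n" "a2 + 14 = 2 * n" using sums eq assms(1) by auto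
    show False
    proof (cases "n = 8")
      case True
      have fin: "finite (L i)" for i using finite_johnson_vertices[of n 4]
        by (auto simp: L_def V_def code_layer_def intro: finite_subset)
      show False
      \<comment> \<open>Merging the outer layers, each outer vertex has \<open>2n - 2 = 14\<close>
        neighbours in the middle, and each middle vertex has \<open>b1 + c1 = n - 4 = 4\<close>
        outside it.\<close>
      proof (rule no_split_8[of "L 0 \<union> L 2" "L 1"])
        show "johnson_vertices 8 4 = L 0 \<union> L 2 \<union> L 1" using VL True by (auto simp: V_def)
        show "nbrs_in (johnson_edges 8 4) v (L 1) = 14" if "v \<in> L 0 \<union> L 2" for v
          using that cnt0 cnt2 b eq True by (auto simp: E_def)
        show "nbrs_in (johnson_edges 8 4) v (L 0 \<union> L 2) = 4" if "v \<in> L 1" for v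
          using bspec[OF cnt1 that] b True fin dj(2) by (simp add: E_def nbrs_in_Un)
      qed (use dj in auto)
    next
      case False
      then have n9: "n \<ge> 9" using assms(1) by simp
      show False
      \<comment> \<open>The role of \<open>X\<close> goes to the outer layer in which a middle
        vertex has fewer neighbours.\<close>
      proof (cases "c1 \<le> b1")
        case True
        show False
          by (rule no_balanced_split[of n "L 0" "L 1" "L 2" c1 b1])
            (use n9 VL dj ne cnt0 cnt1 cnt2 a b pos True in \<open>auto simp: V_def E_def\<close>)
      next
        case False
        show False
          by (rule no_balanced_split[of n "L 2" "L 1" "L 0" b1 c1])
            (use n9 VL dj ne cnt0 cnt1 cnt2 a b pos False in \<open>auto simp: V_def E_def\<close>)
      qed
    qed
  qed
  then have d: "real b0 - real c2 \<noteq> 0" by simp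
  have "real b1 = (real c2 - 2 * N + 2) * (real c2 - 3 * N + 6) / (real b0 - real c2)"
    "real c1 = - ((real b0 - 2 * N + 2) * (real b0 - 3 * N + 6) / (real b0 - real c2))"
    by (simp_all only: minus_divide_left nonzero_eq_divide_eq[OF d] bc1 bc2)
  moreover have "real a1 = real b0 + real c2 - N - 8" using rsums(2) \<sigma> by (simp add: \<sigma>_def)
  ultimately have M': "intersection_matrix V E C = mat_of_rows_list 3
        [[4 * N - 16 - real b0, real b0, 0],
         [- ((real b0 - 2 * N + 2) * (real b0 - 3 * N + 6) / (real b0 - real c2)),
          real b0 + real c2 - N - 8,
          (real c2 - 2 * N + 2) * (real c2 - 3 * N + 6) / (real b0 - real c2)],
         [0, real c2, 4 * N - 16 - real c2]]"
    by (simp only: M rsums(1,3))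
  show ?thesis
    using M' \<open>b0 \<noteq> c2\<close> pos unfolding V_def E_def N_def Let_def
    by (intro exI[of _ "int b0"] exI[of _ "int c2"]) simp
qed

end
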